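(* Let $\mathbf{B}_0:\Omega_x\to\mathbb{R}^3$ be a smooth vector field depending only on $\mathbf{x}$ and satisfying $\nabla\cdot\mathbf{B}_0(\mathbf{x})=0$. For functionals $\mathcal{F},\mathcal{G}$ of $f=f(\mathbf{x},\mathbf{v})$, $(\mathbf{x},\mathbf{v})\in\Omega_x\times\Omega_v$, define $$\{\{\mathcal{F},\mathcal{G}\}\}(f)=\int_{\Omega_x\times\Omega_v} f\left\{\frac{\delta\mathcal{F}}{\delta f},\frac{\delta\mathcal{G}}{\delta f}\right\}_{\mathbf{xv}}d\mathbf{x}\,d\mathbf{v}+\int_{\Omega_x\times\Omega_v} f\,\mathbf{B}_0\cdot\left(\frac{\partial}{\partial\mathbf{v}}\frac{\delta\mathcal{F}}{\delta f}\times\frac{\partial}{\partial\mathbf{v}}\frac{\delta\mathcal{G}}{\delta f}\right)d\mathbf{x}\,d\mathbf{v}.$$ Then this bracket is bilinear and anti-symmetric, and it satisfies the Jacobi identity: for all functionals $\mathcal{F},\mathcal{G},\mathcal{H}$ of $f$, $$\{\{\{\{\mathcal{F},\mathcal{G}\}\},\mathcal{H}\}\}+\{\{\{\{\mathcal{G},\mathcal{H}\}\},\mathcal{F}\}\}+\{\{\{\{\mathcal{H},\mathcal{F}\}\},\mathcal{G}\}\}=0.$$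
   Context: Here $\Omega_x\subset\mathbb{R}^3$ and $\Omega_v\subset\mathbb{R}^3$ are the position and velocity domains. The variational derivative $\frac{\delta\mathcal{G}}{\delta f}$ of a functional $\mathcal{G}[f]$ is the function on $\Omega_x\times\Omega_v$ defined by $$\int_{\Omega_x\times\Omega_v}\frac{\delta\mathcal{G}}{\delta f}\,\delta f\,d\mathbf{x}\,d\mathbf{v}=\lim_{\epsilon\to0}\frac{\mathcal{G}[f+\epsilon\,\delta f]-\mathcal{G}[f]}{\epsilon}$$ for all admissible variations $\delta f$. For functions $m(\mathbf{x},\mathbf{v}),n(\mathbf{x},\mathbf{v})$ the canonical bracket is $$\{m,n\}_{\mathbf{xv}}=\frac{\partial m}{\partial\mathbf{x}}\cdot\frac{\partial n}{\partial\mathbf{v}}-\frac{\partial m}{\partial\mathbf{v}}\cdot\frac{\partial n}{\partial\mathbf{x}}.$$ Conventions: $f$ is smooth, and functionals are those that are twice differentiable in $f$ with smooth first variational derivatives $\frac{\delta\mathcal{F}}{\delta f}(\mathbf{x},\mathbf{v})$ and symmetric (self-adjoint) second variations, such that the brackets involved are again functionals having a variational derivative. Boundary conditions on $f$ (vanishing on the boundary/decay, or periodicity in $\mathbf{x}$ with vanishing/decay in $\mathbf{v}$) are such that all boundary terms arising in integrations by parts over $\Omega_x\times\Omega_v$ vanish. *)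

theory Defs
  imports "HOL-Analysis.Analysis"
begin

section \<open>Smooth functions and differential operators\<close>

text \<open>
  Functions on an open set are represented by total functions; only the values on the
  open set matter.
\<close>

primrec Ck_on :: "nat \<Rightarrow> 'a::euclidean_space set \<Rightarrow> ('a \<Rightarrow> 'b::real_normed_vector) \<Rightarrow> bool" where
  "Ck_on 0 S f \<longleftrightarrow> continuous_on S f"
| "Ck_on (Suc k) S f \<longleftrightarrow>
     (\<forall>x\<in>S. f differentiable (at x)) \<and>
     (\<forall>b\<in>Basis. Ck_on k S (\<lambda>x. frechet_derivative f (at x) b))"

definition smooth_on :: "'a::euclidean_space set \<Rightarrow> ('a \<Rightarrow> 'b::real_normed_vector) \<Rightarrow> bool" where
  "smooth_on S f \<longleftrightarrow> (\<forall>k. Ck_on k S f)"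

definition divergence :: "(real^3 \<Rightarrow> real^3) \<Rightarrow> real^3 \<Rightarrow> real" where
  "divergence B x = (\<Sum>i\<in>UNIV. frechet_derivative B (at x) (axis i 1) $ i)"

type_synonym phase = "(real^3) \<times> (real^3)"
type_synonym phase_fun = "phase \<Rightarrow> real"
type_synonym phase_functional = "phase_fun \<Rightarrow> real"

definition grad_x :: "phase_fun \<Rightarrow> phase \<Rightarrow> real^3" where
  "grad_x m z = (\<chi> i. frechet_derivative m (at z) (axis i 1, 0))"

definition grad_v :: "phase_fun \<Rightarrow> phase \<Rightarrow> real^3" where
  "grad_v m z = (\<chi> i. frechet_derivative m (at z) (0, axis i 1))"

definition canonical_bracket :: "phase_fun \<Rightarrow> phase_fun \<Rightarrow> phase_fun" where
  "canonical_bracket m n z = grad_x m z \<bullet> grad_v n z - grad_v m z \<bullet> grad_x n z"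

definition test_functions :: "phase set \<Rightarrow> phase_fun set" where
  "test_functions \<Omega> =
     {\<phi>. smooth_on UNIV \<phi> \<and> (\<exists>K. compact K \<and> K \<subseteq> \<Omega> \<and> (\<forall>z. z \<notin> K \<longrightarrow> \<phi> z = 0))}"


section \<open>Boundary conditions\<close>

text \<open>
  The boundary conditions enter through three spaces of functions on
  \<open>\<Omega> = \<Omega>x \<times> \<Omega>v\<close>:

  \<^item> \<open>V\<close>: the smooth functions obeying the (homogeneous, linear) boundary conditions, i.e. both
    the states \<open>f\<close> and the admissible variations \<open>\<delta>f\<close>;
  \<^item> \<open>W\<close>: an algebra of smooth functions, stable under differentiation, in which
    variational derivatives take their values;
  \<^item> \<open>U\<close>: a space containing \<open>V\<close> and its first derivatives, on which second variations act.

  Assumption \<open>no_boundary_term\<close> is the vanishing of boundary terms; as \<open>V\<close> is stable under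
  multiplication by \<open>W\<close>, it covers every total derivative of \<open>f * w\<close>.

  Examples: compactly supported smooth functions on \<open>\<Omega>\<close> (\<open>U = V\<close>, \<open>W\<close> all smooth functions);
  rapidly decreasing functions on the whole space (\<open>U = V\<close>, \<open>W\<close> the smooth functions
  with all derivatives of polynomial growth); functions periodic in \<open>x\<close> on a box and rapidly
  decreasing in \<open>v\<close> (\<open>U = V\<close>, \<open>W\<close> as before and periodic in \<open>x\<close>); functions smooth up to the
  boundary of a bounded regular domain which vanish on that boundary (\<open>U = W\<close> all functions
  smooth up to the boundary).
\<close>

locale phase_space_classes =
  fixes \<Omega>x \<Omega>v :: "(real^3) set"
    and V U W :: "phase_fun set"
  assumes open_x: "open \<Omega>x"
    and open_v: "open \<Omega>v"
    \<comment> \<open>only values on the domain matter\<close>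
    and V_cong: "\<And>f g. f \<in> V \<Longrightarrow> (\<And>z. z \<in> \<Omega>x \<times> \<Omega>v \<Longrightarrow> g z = f z) \<Longrightarrow> g \<in> V"
    and U_cong: "\<And>f g. f \<in> U \<Longrightarrow> (\<And>z. z \<in> \<Omega>x \<times> \<Omega>v \<Longrightarrow> g z = f z) \<Longrightarrow> g \<in> U"
    and W_cong: "\<And>f g. f \<in> W \<Longrightarrow> (\<And>z. z \<in> \<Omega>x \<times> \<Omega>v \<Longrightarrow> g z = f z) \<Longrightarrow> g \<in> W"
    and V_smooth: "\<And>f. f \<in> V \<Longrightarrow> smooth_on (\<Omega>x \<times> \<Omega>v) f"
    and W_smooth: "\<And>w. w \<in> W \<Longrightarrow> smooth_on (\<Omega>x \<times> \<Omega>v) w"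
    \<comment> \<open>linear spaces\<close>
    and V_add: "\<And>f g. f \<in> V \<Longrightarrow> g \<in> V \<Longrightarrow> (\<lambda>z. f z + g z) \<in> V"
    and V_scale: "\<And>c f. f \<in> V \<Longrightarrow> (\<lambda>z. c * f z) \<in> V"
    and U_add: "\<And>f g. f \<in> U \<Longrightarrow> g \<in> U \<Longrightarrow> (\<lambda>z. f z + g z) \<in> U"
    and U_scale: "\<And>c f. f \<in> U \<Longrightarrow> (\<lambda>z. c * f z) \<in> U"
    and W_add: "\<And>f g. f \<in> W \<Longrightarrow> g \<in> W \<Longrightarrow> (\<lambda>z. f z + g z) \<in> W"
    and W_scale: "\<And>c f. f \<in> W \<Longrightarrow> (\<lambda>z. c * f z) \<in> W"
    \<comment> \<open>products and derivatives\<close>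
    and W_mult: "\<And>w w'. w \<in> W \<Longrightarrow> w' \<in> W \<Longrightarrow> (\<lambda>z. w z * w' z) \<in> W"
    and V_mult: "\<And>w f. w \<in> W \<Longrightarrow> f \<in> V \<Longrightarrow> (\<lambda>z. w z * f z) \<in> V"
    and U_mult: "\<And>w u. w \<in> W \<Longrightarrow> u \<in> U \<Longrightarrow> (\<lambda>z. w z * u z) \<in> U"
    and W_deriv: "\<And>w b. w \<in> W \<Longrightarrow> b \<in> Basis \<Longrightarrow> (\<lambda>z. frechet_derivative w (at z) b) \<in> W"
    and V_deriv: "\<And>f b. f \<in> V \<Longrightarrow> b \<in> Basis \<Longrightarrow> (\<lambda>z. frechet_derivative f (at z) b) \<in> U"
    and V_subset_U: "V \<subseteq> U"
    \<comment> \<open>there are enough variations\<close>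
    and test_functions_subset_V: "test_functions (\<Omega>x \<times> \<Omega>v) \<subseteq> V"
    and U_integrable: "\<And>u. u \<in> U \<Longrightarrow> set_integrable lborel (\<Omega>x \<times> \<Omega>v) u"
    and no_boundary_term: "\<And>f b. f \<in> V \<Longrightarrow> b \<in> Basis \<Longrightarrow>
          (LINT z:\<Omega>x \<times> \<Omega>v|lborel. frechet_derivative f (at z) b) = 0"


section \<open>Functionals and their variational derivatives\<close>

definition has_variational_derivative ::
    "phase set \<Rightarrow> phase_fun set \<Rightarrow> phase_functional \<Rightarrow> phase_fun \<Rightarrow> phase_fun \<Rightarrow> bool" where
  "has_variational_derivative \<Omega> V G f g \<longleftrightarrow>
     smooth_on \<Omega> g \<and>
     (\<forall>\<phi>\<in>V. set_integrable lborel \<Omega> (\<lambda>z. g z * \<phi> z) \<and>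
        ((\<lambda>\<epsilon>::real. (G (\<lambda>z. f z + \<epsilon> * \<phi> z) - G f) / \<epsilon>)
           \<longlongrightarrow> (LINT z:\<Omega>|lborel. g z * \<phi> z)) (at 0))"

text \<open>If \<open>V\<close> contains the test functions, the function chosen here is unique on \<open>\<Omega>\<close>.\<close>

definition variational_derivative ::
    "phase set \<Rightarrow> phase_fun set \<Rightarrow> phase_functional \<Rightarrow> phase_fun \<Rightarrow> phase_fun" where
  "variational_derivative \<Omega> V G f = (SOME g. has_variational_derivative \<Omega> V G f g)"

definition variationally_differentiable ::
    "phase set \<Rightarrow> phase_fun set \<Rightarrow> phase_fun set \<Rightarrow> phase_functional \<Rightarrow> bool" where
  "variationally_differentiable \<Omega> V W G \<longleftrightarrow>
     (\<forall>f\<in>V. \<exists>g\<in>W. has_variational_derivative \<Omega> V G f g)"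

text \<open>
  Convergence to \<open>0\<close>, as \<open>\<epsilon> \<rightarrow> 0\<close>, in the weighted Sobolev spaces
  \<open>H\<^sup>1(\<Omega>; \<bar>h\<bar> dx dv)\<close> for all weights \<open>h \<in> U\<close>.
\<close>

definition weighted_H1_null ::
    "phase set \<Rightarrow> phase_fun set \<Rightarrow> (real \<Rightarrow> phase_fun) \<Rightarrow> bool" where
  "weighted_H1_null \<Omega> U r \<longleftrightarrow>
     (\<forall>h\<in>U. ((\<lambda>\<epsilon>. LINT z:\<Omega>|lborel.
          \<bar>h z\<bar> * ((r \<epsilon> z)\<^sup>2 + (norm (grad_x (r \<epsilon>) z))\<^sup>2 + (norm (grad_v (r \<epsilon>) z))\<^sup>2))
        \<longlongrightarrow> 0) (at 0))"

text \<open>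
  \<open>S\<close> is the second variation of \<open>G\<close> at \<open>f\<close>, written as an operator: it is the directional
  derivative of \<open>f \<mapsto> \<delta>G/\<delta>f\<close>, and it is self-adjoint.
\<close>

definition has_second_variation ::
    "phase set \<Rightarrow> phase_fun set \<Rightarrow> phase_fun set \<Rightarrow> phase_fun set \<Rightarrow> phase_functional \<Rightarrow> phase_fun
       \<Rightarrow> (phase_fun \<Rightarrow> phase_fun) \<Rightarrow> bool" where
  "has_second_variation \<Omega> V U W G f S \<longleftrightarrow>
     (\<forall>\<phi>\<in>U. S \<phi> \<in> W) \<and>
     (\<forall>\<phi>\<in>V. weighted_H1_null \<Omega> U
        (\<lambda>\<epsilon> z. (variational_derivative \<Omega> V G (\<lambda>y. f y + \<epsilon> * \<phi> y) z
                 - variational_derivative \<Omega> V G f z) / \<epsilon> - S \<phi> z)) \<and>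
     (\<forall>\<phi>\<in>U. \<forall>\<psi>\<in>U. (LINT z:\<Omega>|lborel. S \<phi> z * \<psi> z) = (LINT z:\<Omega>|lborel. \<phi> z * S \<psi> z))"

definition is_functional ::
    "phase set \<Rightarrow> phase_fun set \<Rightarrow> phase_fun set \<Rightarrow> phase_fun set \<Rightarrow> phase_functional \<Rightarrow> bool" where
  "is_functional \<Omega> V U W G \<longleftrightarrow>
     variationally_differentiable \<Omega> V W G \<and>
     (\<forall>f\<in>V. \<exists>S. has_second_variation \<Omega> V U W G f S)"


section \<open>The bracket\<close>

definition magnetic_bracket ::
    "phase set \<Rightarrow> phase_fun set \<Rightarrow> (real^3 \<Rightarrow> real^3)
       \<Rightarrow> phase_functional \<Rightarrow> phase_functional \<Rightarrow> phase_functional" where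
  "magnetic_bracket \<Omega> V B F G f =
     (LINT z:\<Omega>|lborel.
        f z * canonical_bracket (variational_derivative \<Omega> V F f) (variational_derivative \<Omega> V G f) z)
   + (LINT z:\<Omega>|lborel.
        f z * (B (fst z) \<bullet> cross3 (grad_v (variational_derivative \<Omega> V F f) z)
                                   (grad_v (variational_derivative \<Omega> V G f) z)))"

end

theory Submission
  imports Defs
begin

text \<open>
  Write \<open>m = \<delta>F/\<delta>f\<close>, \<open>n = \<delta>G/\<delta>f\<close>, \<open>h = \<delta>H/\<delta>f\<close>. The integrand of the bracket is \<open>f\<close> times
  a single biderivation \<open>[m, n] = (\<Sum>a b. \<pi> a b * \<partial>a m * \<partial>b n)\<close>, the sum running over the coordinate
  directions of phase space, whose antisymmetric tensor \<open>\<pi>\<close> depends on \<open>z\<close> only through \<open>B0\<close>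
  (lemma \<open>poisson_bracket_eq\<close>). Three facts about \<open>\<pi>\<close> drive everything: it is antisymmetric; it is
  divergence free, because the entries containing \<open>B0 x\<close> only involve velocity directions, so that
  \<open>[u, h]\<close> is a total derivative and \<open>\<integral> u [w, h] = \<integral> w [h, u]\<close> (lemma \<open>bracket_by_parts\<close>); and
  \<open>[\<cdot>, \<cdot>]\<close> satisfies the pointwise Jacobi identity, the obstruction being the trace of the derivative
  of \<open>B0\<close> times a determinant (lemmas \<open>trace_free_cyclic\<close> and \<open>pb_jacobi\<close>). Bilinearity and
  antisymmetry follow at once, because a variational derivative is unique on the domain
  (lemma \<open>has_variational_derivative_unique\<close>).

  For the Jacobi identity one needs the variational derivative of the functional \<open>{{F, G}}\<close>. Let \<open>S\<close>
  and \<open>T\<close> be the second variations of \<open>F\<close> and \<open>G\<close> at \<open>f\<close>. In a direction \<open>\<psi>\<close> the bracket varies by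
  \<open>\<integral> \<psi> [m, n] + \<integral> f [S \<psi>, n] + \<integral> f [m, T \<psi>]\<close> (lemma \<open>bracket_first_variation\<close>). Integration by
  parts and self-adjointness turn this into \<open>\<integral> \<psi> ([m, n] + S [n, f] + T [f, m])\<close>, which identifies
  the variational derivative of the bracket (lemma \<open>vd_magnetic_bracket\<close>). Another integration by
  parts gives
  \<open>{{{{F, G}}, H}} = \<integral> f [[m, n], h] + \<integral> S [n, f] * [h, f] + \<integral> T [f, m] * [h, f]\<close>.
  In the cyclic sum the first terms cancel by the pointwise Jacobi identity. Each second variation
  occurs twice, and the two occurrences cancel by self-adjointness; for \<open>S\<close> they are
  \<open>\<integral> S [n, f] * [h, f]\<close> and \<open>\<integral> S [f, h] * [n, f]\<close> (lemma \<open>second_variation_swap\<close>).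

  Integrating by parts in this order matters: the derivatives of \<open>f\<close> may violate the boundary conditions,
  so \<open>[n, f]\<close> need not be an admissible variation and the variational derivative of \<open>{{F, G}}\<close> can then not
  be tested against it. It does belong to \<open>U\<close>, on which the second variations act.
\<close>

section \<open>Partial derivatives\<close>

definition pd :: "'a::euclidean_space \<Rightarrow> ('a \<Rightarrow> real) \<Rightarrow> 'a \<Rightarrow> real" where
  "pd b m z = frechet_derivative m (at z) b"

lemma pd_has_derivative:
  assumes "(m has_derivative m') (at z)"
  shows "pd b m z = m' b"
  using frechet_derivative_at[OF assms] by (simp add: pd_def)

text \<open>Membership in the spaces \<open>V\<close>, \<open>U\<close>, \<open>W\<close> and equality of variational derivatives only concern the
  values on the open domain. This lemma transfers derivatives along such equalities.\<close>

lemma pd_cong: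
  assumes "open S" "z \<in> S" "\<And>y. y \<in> S \<Longrightarrow> m y = n y"
  shows "pd b m z = pd b n z"
proof -
  have "(m has_derivative D) (at z) \<longleftrightarrow> (n has_derivative D) (at z)" for D
    using has_derivative_transform_within_open[OF _ assms(1,2), of m D UNIV n]
      has_derivative_transform_within_open[OF _ assms(1,2), of n D UNIV m] assms(3)
    by auto
  then show ?thesis by (simp add: pd_def frechet_derivative_def)
qed

lemma pd_add:
  assumes "m differentiable (at z)" "n differentiable (at z)"
  shows "pd b (\<lambda>y. m y + n y) z = pd b m z + pd b n z"
  unfolding pd_def
  using frechet_derivative_at[OF has_derivative_add[OF assms[unfolded frechet_derivative_works]]]
  by metis

lemma pd_mult:
  assumes "m differentiable (at z)" "n differentiable (at z)"
  shows "pd b (\<lambda>y. m y * n y) z = m z * pd b n z + pd b m z * n z"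
  unfolding pd_def
  using frechet_derivative_at[OF has_derivative_mult[OF assms[unfolded frechet_derivative_works]]]
  by metis

lemma pd_scale:
  assumes "m differentiable (at z)"
  shows "pd b (\<lambda>y. c * m y) z = c * pd b m z"
  using pd_mult[of "\<lambda>_. c", OF _ assms] by (simp add: pd_def)

lemma pd_sum:
  assumes "finite A" "\<And>i. i \<in> A \<Longrightarrow> m i differentiable (at z)"
  shows "pd b (\<lambda>y. \<Sum>i\<in>A. m i y) z = (\<Sum>i\<in>A. pd b (m i) z)"
  using assms
proof (induction A rule: finite_induct)
  case empty
  then show ?case by (simp add: pd_def)
next
  case (insert i A)
  then have "(\<lambda>y. \<Sum>i\<in>A. m i y) differentiable (at z)" by (intro differentiable_sum) auto
  then show ?case using insert by (simp add: pd_add)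
qed

lemma pd_line:
  fixes m :: "'a::euclidean_space \<Rightarrow> real"
  assumes "m differentiable (at (p + s *\<^sub>R b))"
  shows "((\<lambda>t. m (p + t *\<^sub>R b)) has_real_derivative pd b m (p + s *\<^sub>R b)) (at s)"
proof -
  let ?D = "frechet_derivative m (at (p + s *\<^sub>R b))"
  have D: "(m has_derivative ?D) (at (p + s *\<^sub>R b))"
    using assms by (simp add: frechet_derivative_works)
  have "((\<lambda>t. m (p + t *\<^sub>R b)) has_derivative (\<lambda>t. ?D (t *\<^sub>R b))) (at s)"
    by (rule has_derivative_compose[of "\<lambda>t. p + t *\<^sub>R b" _ s UNIV m, OF _ D]) (auto intro!: derivative_eq_intros)
  moreover have "?D (t *\<^sub>R b) = pd b m (p + s *\<^sub>R b) * t" for t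
    using linear_frechet_derivative[OF assms] by (simp add: pd_def linear_cmul)
  ultimately show ?thesis by (simp add: has_field_derivative_def mult_commute_abs)
qed

text \<open>The classical route to the symmetry of second derivatives: the mean value theorem, first along
  \<open>a\<close>, then along \<open>b\<close>, turns the second difference over a parallelogram into a mixed derivative at
  an interior point. The left-hand side is symmetric in \<open>a\<close> and \<open>b\<close>.\<close>

lemma second_difference_mvt:
  fixes f :: "'a::euclidean_space \<Rightarrow> real"
  assumes h: "0 < h"
    and d1: "\<And>s t. 0 \<le> s \<Longrightarrow> s \<le> h \<Longrightarrow> 0 \<le> t \<Longrightarrow> t \<le> h \<Longrightarrow> f differentiable (at (z + s *\<^sub>R a + t *\<^sub>R b))"
    and d2: "\<And>s t. 0 \<le> s \<Longrightarrow> s \<le> h \<Longrightarrow> 0 \<le> t \<Longrightarrow> t \<le> h \<Longrightarrow> pd a f differentiable (at (z + s *\<^sub>R a + t *\<^sub>R b))"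
  obtains s t where "0 < s" "s < h" "0 < t" "t < h"
    "f (z + h *\<^sub>R a + h *\<^sub>R b) - f (z + h *\<^sub>R a) - f (z + h *\<^sub>R b) + f z
       = h\<^sup>2 * pd b (pd a f) (z + s *\<^sub>R a + t *\<^sub>R b)"
proof -
  let ?g = "\<lambda>s. f ((z + h *\<^sub>R b) + s *\<^sub>R a) - f (z + s *\<^sub>R a)"
  have "(?g has_real_derivative pd a f ((z + h *\<^sub>R b) + s *\<^sub>R a) - pd a f (z + s *\<^sub>R a)) (at s)"
    if "0 \<le> s" "s \<le> h" for s
    by (intro DERIV_diff pd_line)
      (use d1[OF that, of h] d1[OF that, of 0] h in \<open>simp_all add: add_ac\<close>)
  from MVT2[OF h this] obtain s where s: "0 < s" "s < h"
    "?g h - ?g 0 = h * (pd a f ((z + h *\<^sub>R b) + s *\<^sub>R a) - pd a f (z + s *\<^sub>R a))" by auto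
  have "((\<lambda>t. pd a f (z + s *\<^sub>R a + t *\<^sub>R b)) has_real_derivative
          pd b (pd a f) (z + s *\<^sub>R a + t *\<^sub>R b)) (at t)" if "0 \<le> t" "t \<le> h" for t
    by (rule pd_line) (use d2[of s t] s that in auto)
  from MVT2[OF h this] obtain t where t: "0 < t" "t < h"
    "pd a f (z + s *\<^sub>R a + h *\<^sub>R b) - pd a f (z + s *\<^sub>R a + 0 *\<^sub>R b)
      = h * pd b (pd a f) (z + s *\<^sub>R a + t *\<^sub>R b)" by auto
  from s(3) t(3) have "f (z + h *\<^sub>R a + h *\<^sub>R b) - f (z + h *\<^sub>R a) - f (z + h *\<^sub>R b) + f z
       = h\<^sup>2 * pd b (pd a f) (z + s *\<^sub>R a + t *\<^sub>R b)"
    by (simp add: power2_eq_square add_ac)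
  with s t show ?thesis by (intro that)
qed

text \<open>As the parallelogram shrinks, the second difference quotients converge to both mixed derivatives.\<close>

lemma pd_commute:
  fixes f :: "'a::euclidean_space \<Rightarrow> real"
  assumes S: "open S" "z \<in> S"
    and d: "\<And>y. y \<in> S \<Longrightarrow> f differentiable (at y)"
    and da: "\<And>y. y \<in> S \<Longrightarrow> pd a f differentiable (at y)"
    and db: "\<And>y. y \<in> S \<Longrightarrow> pd b f differentiable (at y)"
    and cab: "isCont (pd b (pd a f)) z" and cba: "isCont (pd a (pd b f)) z"
  shows "pd a (pd b f) z = pd b (pd a f) z"
proof -
  obtain r where r: "r > 0" "ball z r \<subseteq> S" using S open_contains_ball by blast
  define M where "M = norm a + norm b + 1"
  have M: "M > 0" by (simp add: M_def add_nonneg_pos)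
  have near: "z + s *\<^sub>R a + t *\<^sub>R b \<in> ball z (h * M)"
    if "0 \<le> s" "s \<le> h" "0 \<le> t" "t \<le> h" "0 < h" for s t h
  proof -
    have "norm (s *\<^sub>R a + t *\<^sub>R b) \<le> norm (s *\<^sub>R a) + norm (t *\<^sub>R b)" by (rule norm_triangle_ineq)
    also have "\<dots> \<le> h * norm a + h * norm b"
      using that by (auto intro!: add_mono mult_right_mono)
    also have "\<dots> < h * M" using that by (simp add: algebra_simps M_def)
    finally show ?thesis by (metis add.assoc add_diff_cancel_left' dist_norm mem_ball dist_commute)
  qed
  have ex: "\<exists>p q. p \<in> ball z (h * M) \<and> q \<in> ball z (h * M) \<and> pd b (pd a f) p = pd a (pd b f) q"
    if h: "0 < h" "h * M \<le> r" for h
  proof -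
    have inS: "z + s *\<^sub>R a + t *\<^sub>R b \<in> S" if "0 \<le> s" "s \<le> h" "0 \<le> t" "t \<le> h" for s t
      using near[OF that h(1)] h r by (auto simp: subset_iff)
    have inS': "z + t *\<^sub>R b + s *\<^sub>R a \<in> S" if "0 \<le> t" "t \<le> h" "0 \<le> s" "s \<le> h" for s t
      using inS[of s t] that by (simp add: add_ac)
    obtain s t where st: "0 < s" "s < h" "0 < t" "t < h"
      "f (z + h *\<^sub>R a + h *\<^sub>R b) - f (z + h *\<^sub>R a) - f (z + h *\<^sub>R b) + f z
       = h\<^sup>2 * pd b (pd a f) (z + s *\<^sub>R a + t *\<^sub>R b)"
      by (rule second_difference_mvt[OF h(1), of f z a b]) (use inS d da in blast)+
    obtain t' s' where st': "0 < t'" "t' < h" "0 < s'" "s' < h"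
      "f (z + h *\<^sub>R b + h *\<^sub>R a) - f (z + h *\<^sub>R b) - f (z + h *\<^sub>R a) + f z
       = h\<^sup>2 * pd a (pd b f) (z + t' *\<^sub>R b + s' *\<^sub>R a)"
      by (rule second_difference_mvt[OF h(1), of f z b a]) (use inS' d db in blast)+
    have "h\<^sup>2 * pd b (pd a f) (z + s *\<^sub>R a + t *\<^sub>R b) = h\<^sup>2 * pd a (pd b f) (z + s' *\<^sub>R a + t' *\<^sub>R b)"
    proof -
      have eqs: "z + h *\<^sub>R b + h *\<^sub>R a = z + h *\<^sub>R a + h *\<^sub>R b"
        "z + t' *\<^sub>R b + s' *\<^sub>R a = z + s' *\<^sub>R a + t' *\<^sub>R b" by (simp_all add: add_ac)
      show ?thesis using st(5) st'(5)[unfolded eqs] by linarith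
    qed
    then show ?thesis using h near[of s h t] near[of s' h t'] st st' by (auto simp: mult_left_cancel)
  qed
  \<comment> \<open>scales for which the parallelogram at \<open>z\<close> spanned by \<open>h n *\<^sub>R a\<close> and \<open>h n *\<^sub>R b\<close> stays in the ball\<close>
  define h where "h n = r / M / real (Suc n)" for n
  have hM: "h n * M = r * inverse (real (Suc n))" for n
    using M by (simp add: h_def divide_inverse)
  have h: "0 < h n" "h n * M \<le> r" for n
    using r M mult_left_mono[of "inverse (real (Suc n))" 1 r]
    by (simp_all add: hM) (simp_all add: h_def inverse_le_1_iff)
  have h0: "(\<lambda>n. h n * M) \<longlonglongrightarrow> 0"
    unfolding hM using tendsto_mult[OF tendsto_const LIMSEQ_inverse_real_of_nat, of r] by simp
  obtain p q where pq: "\<And>n. p n \<in> ball z (h n * M)" "\<And>n. q n \<in> ball z (h n * M)"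
    "\<And>n. pd b (pd a f) (p n) = pd a (pd b f) (q n)"
    using ex[OF h] by metis
  have lim: "x \<longlonglongrightarrow> z" if "\<And>n. x n \<in> ball z (h n * M)" for x
    by (rule metric_tendsto_imp_tendsto[OF h0]) (use that in \<open>auto simp: dist_commute less_imp_le intro!: always_eventually order.trans[OF less_imp_le abs_ge_self]\<close>)
  have "(\<lambda>n. pd b (pd a f) (p n)) \<longlonglongrightarrow> pd b (pd a f) z"
    using isCont_tendsto_compose[OF cab lim[OF pq(1)]] .
  moreover have "(\<lambda>n. pd a (pd b f) (q n)) \<longlonglongrightarrow> pd a (pd b f) z"
    using isCont_tendsto_compose[OF cba lim[OF pq(2)]] .
  ultimately show ?thesis using LIMSEQ_unique by (simp add: pq(3))
qed

section \<open>Smooth bumps and the fundamental lemma of the calculus of variations\<close>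

text \<open>Carrying the negative powers of \<open>t\<close> along
  makes the span of the family closed under differentiation, so that no formula for higher
  derivatives is needed.\<close>

definition flat :: "nat \<Rightarrow> real \<Rightarrow> real" where
  "flat n t = (if t > 0 then exp (- 1 / t) / t ^ n else 0)"

lemma flat_deriv:
  "(flat n has_real_derivative flat (n + 2) t - real n * flat (n + 1) t) (at t)"
proof -
  consider "t > 0" | "t < 0" | "t = 0" by linarith
  then show ?thesis
  proof cases
    case 1
    have e: "((\<lambda>t. exp (- 1 / t)) has_real_derivative exp (- 1 / t) / t\<^sup>2) (at t)"
      using 1 by (auto intro!: derivative_eq_intros simp: power2_eq_square)
    have "real n * t ^ (n - Suc 0) = real n * (t ^ n / t)"
      using 1 by (cases n) auto
    then have p: "((\<lambda>t. t ^ n) has_real_derivative real n * (t ^ n / t)) (at t)"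
      using DERIV_pow[of n t UNIV] by simp
    have "((\<lambda>t. exp (- 1 / t) / t ^ n) has_real_derivative
            exp (- 1 / t) / t ^ (n + 2) - real n * (exp (- 1 / t) / t ^ (n + 1))) (at t)"
      by (rule DERIV_cong[OF DERIV_divide[OF e p]])
        (use 1 in \<open>simp_all add: field_simps power2_eq_square\<close>)
    then have "(flat n has_real_derivative
            exp (- 1 / t) / t ^ (n + 2) - real n * (exp (- 1 / t) / t ^ (n + 1))) (at t)"
      by (rule has_field_derivative_transform_within_open[where S = "{0<..}"]) (use 1 in \<open>auto simp: flat_def\<close>)
    then show ?thesis using 1 by (simp add: flat_def)
  next
    case 2
    have "((\<lambda>t. 0) has_real_derivative 0) (at t)" by simp
    then have "(flat n has_real_derivative 0) (at t)"
      by (rule has_field_derivative_transform_within_open[where S = "{..<0}"]) (use 2 in \<open>auto simp: flat_def\<close>)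
    then show ?thesis using 2 by (simp add: flat_def)
  next
    case 3
    have "((\<lambda>t. inverse t ^ (n + 1) / exp (inverse t)) \<longlongrightarrow> 0) (at_right (0::real))"
      by (rule filterlim_compose[OF tendsto_power_div_exp_0 filterlim_inverse_at_top_right])
    then have "((\<lambda>t. exp (- 1 / t) / t ^ (n + 1)) \<longlongrightarrow> 0) (at_right (0::real))"
      by (simp add: divide_inverse exp_minus power_inverse mult.commute)
    then have R: "((\<lambda>t. flat n t / t) \<longlongrightarrow> 0) (at_right 0)"
      by (rule Lim_transform_eventually)
        (auto simp: flat_def eventually_at_right_field intro!: exI[of _ 1])
    have L: "((\<lambda>t. flat n t / t) \<longlongrightarrow> 0) (at_left 0)"
      by (rule Lim_transform_eventually[OF tendsto_const])
        (auto simp: flat_def eventually_at_left_field intro!: exI[of _ "-1"])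
    from L R have "((\<lambda>t. flat n t / t) \<longlongrightarrow> 0) (at 0)" by (simp add: filterlim_split_at)
    then show ?thesis using 3 by (simp add: has_field_derivative_iff flat_def)
  qed
qed

text \<open>An algebra of functions that contains the bump
  \<open>\<lambda>z. flat 0 (r\<^sup>2 - (z - c) \<bullet> (z - c))\<close> on the ball of radius \<open>r\<close> about \<open>c\<close> and is closed under
  partial derivatives. All its members are then smooth at once.\<close>

inductive bump_algebra :: "'a::euclidean_space \<Rightarrow> real \<Rightarrow> ('a \<Rightarrow> real) \<Rightarrow> bool" for c r where
  const: "bump_algebra c r (\<lambda>z. k)"
| coord: "bump_algebra c r (\<lambda>z. (z - c) \<bullet> b)"
| flat: "bump_algebra c r (\<lambda>z. flat n (r\<^sup>2 - (z - c) \<bullet> (z - c)))"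
| add: "bump_algebra c r \<phi> \<Longrightarrow> bump_algebra c r \<psi> \<Longrightarrow> bump_algebra c r (\<lambda>z. \<phi> z + \<psi> z)"
| mult: "bump_algebra c r \<phi> \<Longrightarrow> bump_algebra c r \<psi> \<Longrightarrow> bump_algebra c r (\<lambda>z. \<phi> z * \<psi> z)"

lemma bump_algebra_deriv:
  assumes "bump_algebra c r \<phi>"
  shows "\<exists>D. (\<forall>z. (\<phi> has_derivative D z) (at z)) \<and> (\<forall>b. bump_algebra c r (\<lambda>z. D z b))"
  using assms
proof induction
  case (const k)
  then show ?case by (intro exI[of _ "\<lambda>_ _. 0"]) (auto intro: bump_algebra.const)
next
  case (coord b)
  then show ?case
    by (intro exI[of _ "\<lambda>_ x. x \<bullet> b"]) (auto intro!: derivative_eq_intros intro: bump_algebra.const)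
next
  case (flat n)
  let ?q = "\<lambda>z. r\<^sup>2 - (z - c) \<bullet> (z - c)"
  let ?D = "\<lambda>z x. (flat (n + 2) (?q z) + (- real n) * flat (n + 1) (?q z)) * (- 2 * ((z - c) \<bullet> x))"
  have "((\<lambda>z. flat n (?q z)) has_derivative ?D z) (at z)" for z
  proof -
    have "(?q has_derivative (\<lambda>x. - 2 * ((z - c) \<bullet> x))) (at z)"
      by (auto intro!: derivative_eq_intros simp: inner_commute)
    from has_derivative_compose[OF this flat_deriv[unfolded has_field_derivative_def]]
    show ?thesis by simp
  qed
  moreover have "bump_algebra c r (\<lambda>z. ?D z b)" for b
    by (intro bump_algebra.intros)
  ultimately show ?case by (intro exI[of _ ?D] conjI allI)
next
  case (add \<phi> \<psi>)
  then obtain D E where "\<forall>z. (\<phi> has_derivative D z) (at z)" "\<forall>b. bump_algebra c r (\<lambda>z. D z b)"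
    "\<forall>z. (\<psi> has_derivative E z) (at z)" "\<forall>b. bump_algebra c r (\<lambda>z. E z b)" by blast
  then show ?case
    by (intro exI[of _ "\<lambda>z x. D z x + E z x"]) (auto intro!: has_derivative_add bump_algebra.add)
next
  case (mult \<phi> \<psi>)
  then obtain D E where DE: "\<forall>z. (\<phi> has_derivative D z) (at z)" "\<forall>b. bump_algebra c r (\<lambda>z. D z b)"
    "\<forall>z. (\<psi> has_derivative E z) (at z)" "\<forall>b. bump_algebra c r (\<lambda>z. E z b)" by blast
  show ?case
    by (intro exI[of _ "\<lambda>z x. \<phi> z * E z x + D z x * \<psi> z"] conjI allI has_derivative_mult
          bump_algebra.add bump_algebra.mult mult.hyps) (use DE in auto)
qed

lemma bump_algebra_smooth:
  assumes "bump_algebra c r \<phi>"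
  shows "smooth_on UNIV \<phi>"
proof -
  have "Ck_on k UNIV \<phi>" for k
    using assms
  proof (induction k arbitrary: \<phi>)
    case 0
    then obtain D where "\<forall>z. (\<phi> has_derivative D z) (at z)" using bump_algebra_deriv by blast
    then show ?case by (auto intro!: has_derivative_continuous continuous_at_imp_continuous_on)
  next
    case (Suc k)
    then obtain D where D: "\<forall>z. (\<phi> has_derivative D z) (at z)" "\<forall>b. bump_algebra c r (\<lambda>z. D z b)"
      using bump_algebra_deriv by blast
    then have "frechet_derivative \<phi> (at z) = D z" for z using frechet_derivative_at by metis
    with D Suc.IH show ?case by (auto simp: differentiable_def)
  qed
  then show ?thesis by (simp add: smooth_on_def)
qed

lemma bump_exists:
  fixes c :: phase
  assumes r: "r > 0" and sub: "cball c r \<subseteq> \<Omega>"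
  obtains \<phi> where "\<phi> \<in> test_functions \<Omega>" "\<And>z. \<phi> z \<ge> 0" "\<And>z. \<phi> z > 0 \<longleftrightarrow> z \<in> ball c r"
proof
  let ?\<phi> = "\<lambda>z. flat 0 (r\<^sup>2 - (z - c) \<bullet> (z - c))"
  show pos: "?\<phi> z > 0 \<longleftrightarrow> z \<in> ball c r" for z
  proof -
    have "?\<phi> z > 0 \<longleftrightarrow> (norm (z - c))\<^sup>2 < r\<^sup>2" by (simp add: flat_def dot_square_norm)
    also have "\<dots> \<longleftrightarrow> norm (z - c) < r"
      using r by (metis norm_ge_zero order_less_imp_le power2_less_imp_less power_strict_mono zero_less_numeral)
    finally show ?thesis by (simp add: dist_norm norm_minus_commute)
  qed
  show ge: "?\<phi> z \<ge> 0" for z by (simp add: flat_def)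
  have "?\<phi> z = 0" if "z \<notin> cball c r" for z
    using that pos[of z] ge[of z] by force
  then show "?\<phi> \<in> test_functions \<Omega>"
    using sub bump_algebra_smooth[OF bump_algebra.flat[where c = c and r = r and n = 0]]
    by (auto simp: test_functions_def intro!: exI[of _ "cball c r"])
qed

text \<open>If \<open>g c \<noteq> 0\<close>, then \<open>g\<close> has a constant sign near \<open>c\<close>, and a bump supported there has a nonzero
  integral against \<open>g\<close>.\<close>

lemma fundamental_lemma:
  fixes g :: phase_fun
  assumes \<Omega>: "open \<Omega>" and cont: "continuous_on \<Omega> g"
    and int: "\<And>\<phi>. \<phi> \<in> test_functions \<Omega> \<Longrightarrow> set_integrable lborel \<Omega> (\<lambda>z. g z * \<phi> z)"
    and zero: "\<And>\<phi>. \<phi> \<in> test_functions \<Omega> \<Longrightarrow> (LINT z:\<Omega>|lborel. g z * \<phi> z) = 0"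
    and c: "c \<in> \<Omega>"
  shows "g c = 0"
proof (rule ccontr)
  assume "g c \<noteq> 0"
  define s where "s = sgn (g c)"
  have "s * g c > 0" using \<open>g c \<noteq> 0\<close> by (simp add: s_def sgn_mult_self_eq abs_sgn[symmetric] mult.commute)
  moreover have "continuous_on \<Omega> (\<lambda>z. s * g z)" by (intro continuous_intros cont)
  then have "open ((\<lambda>z. s * g z) -` {0<..} \<inter> \<Omega>)"
    using \<Omega> by (simp add: continuous_on_open_vimage)
  ultimately obtain r where r: "r > 0" "cball c r \<subseteq> (\<lambda>z. s * g z) -` {0<..} \<inter> \<Omega>"
    using c by (metis (no_types, lifting) IntI greaterThan_iff open_contains_cball vimageI)
  obtain \<phi> where \<phi>: "\<phi> \<in> test_functions \<Omega>" "\<And>z. \<phi> z \<ge> 0" "\<And>z. \<phi> z > 0 \<longleftrightarrow> z \<in> ball c r"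
    using bump_exists[of r c \<Omega>] r by (metis Int_subset_iff)
  let ?k = "\<lambda>z. s * (indicat_real \<Omega> z *\<^sub>R (g z * \<phi> z))"
  have k0: "?k z \<ge> 0" for z
  proof (cases "z \<in> ball c r")
    case True
    then have "z \<in> cball c r" by auto
    then have "s * g z > 0" using r by blast
    then show ?thesis using \<phi>(2)[of z] by (simp add: indicator_def mult.assoc[symmetric])
  next
    case False
    then have "\<phi> z = 0" using \<phi>(2,3)[of z] by force
    then show ?thesis by simp
  qed
  have ki: "integrable lborel ?k"
    using int[OF \<phi>(1)] by (auto simp: set_integrable_def)
  have "integral\<^sup>L lborel ?k = 0"
    using zero[OF \<phi>(1)] by (simp add: set_lebesgue_integral_def)
  then have AE0: "AE z in lborel. ?k z = 0"
    using integral_nonneg_eq_0_iff_AE[OF ki] k0 by simp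
  have pos: "?k z \<noteq> 0" if "z \<in> ball c r" for z
  proof -
    have "z \<in> cball c r" using that by auto
    then have "s * g z > 0" "z \<in> \<Omega>" "\<phi> z > 0" using that r \<phi>(3) by blast+
    then show ?thesis by auto
  qed
  have "AE z in lborel. z \<notin> ball c r" by (rule eventually_mono[OF AE0]) (use pos in blast)
  then have "emeasure lborel (ball c r) = 0"
    by (subst (asm) AE_iff_measurable[where N = "ball c r"]) auto
  then show False
    using content_ball_pos[OF r(1), of c] by (simp add: measure_def)
qed

section \<open>The Poisson tensor of the magnetic bracket\<close>

text \<open>The tensor is evaluated on arbitrary phase space vectors \<open>a\<close> and \<open>b\<close>; its components are the
  values on the standard basis.\<close>

definition poisson_tensor :: "(real^3 \<Rightarrow> real^3) \<Rightarrow> phase \<Rightarrow> phase \<Rightarrow> phase_fun" where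
  "poisson_tensor B a b z =
     fst a \<bullet> snd b - snd a \<bullet> fst b + B (fst z) \<bullet> cross3 (snd a) (snd b)"

definition poisson_bracket :: "(real^3 \<Rightarrow> real^3) \<Rightarrow> phase_fun \<Rightarrow> phase_fun \<Rightarrow> phase_fun" where
  "poisson_bracket B m n z =
     (\<Sum>a\<in>Basis. \<Sum>b\<in>Basis. poisson_tensor B a b z * (pd a m z * pd b n z))"

text \<open>The components of the vector field \<open>X\<close> such that \<open>[m, h]\<close> is the derivative of \<open>m\<close> along \<open>X\<close>.\<close>

definition hamiltonian_field :: "(real^3 \<Rightarrow> real^3) \<Rightarrow> phase_fun \<Rightarrow> phase \<Rightarrow> phase_fun" where
  "hamiltonian_field B h a z = (\<Sum>b\<in>Basis. poisson_tensor B a b z * pd b h z)"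

lemma poisson_tensor_antisym: "poisson_tensor B b a z = - poisson_tensor B a b z"
  using cross_skew[of "snd a" "snd b"] by (simp add: poisson_tensor_def inner_commute)

lemma poisson_bracket_hamiltonian_right:
  "poisson_bracket B m h z = (\<Sum>a\<in>Basis. pd a m z * hamiltonian_field B h a z)"
  by (simp add: poisson_bracket_def hamiltonian_field_def sum_distrib_left mult_ac)

lemma poisson_bracket_antisym: "poisson_bracket B n m z = - poisson_bracket B m n z"
proof -
  have "poisson_bracket B n m z
      = (\<Sum>a\<in>Basis. \<Sum>b\<in>Basis. poisson_tensor B b a z * (pd b n z * pd a m z))"
    unfolding poisson_bracket_def by (rule sum.swap)
  also have "\<dots> = (\<Sum>a\<in>Basis. \<Sum>b\<in>Basis. - (poisson_tensor B a b z * (pd a m z * pd b n z)))"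
    by (intro sum.cong refl) (subst poisson_tensor_antisym, simp add: mult_ac)
  finally show ?thesis by (simp add: sum_negf poisson_bracket_def)
qed

lemma sum_Basis_phase:
  "(\<Sum>a\<in>(Basis :: phase set). k a) = (\<Sum>i\<in>UNIV. k (axis i 1, 0)) + (\<Sum>i\<in>UNIV. k (0, axis i 1))"
proof -
  have B: "(Basis :: (real^3) set) = (\<lambda>i. axis i 1) ` UNIV" by (auto simp: Basis_vec_def)
  have inj: "inj (\<lambda>i::3. axis i (1::real))" by (auto simp: inj_on_def axis_eq_axis)
  have "(\<Sum>a\<in>(Basis :: phase set). k a)
      = (\<Sum>a\<in>(\<lambda>u. (u, 0)) ` Basis. k a) + (\<Sum>a\<in>(\<lambda>v. (0, v)) ` Basis. k a)"
    unfolding Basis_prod_def by (rule sum.union_disjoint) (auto simp: nonzero_Basis)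
  also have "\<dots> = (\<Sum>u\<in>Basis. k (u, 0)) + (\<Sum>v\<in>Basis. k (0, v))"
    by (simp add: sum.reindex inj_on_def)
  also have "\<dots> = (\<Sum>i\<in>UNIV. k (axis i 1, 0)) + (\<Sum>i\<in>UNIV. k (0, axis i 1))"
    using inj by (simp add: B sum.reindex)
  finally show ?thesis .
qed

lemma grad_x_pd: "grad_x m z $ i = pd (axis i 1, 0) m z"
  by (simp add: grad_x_def pd_def)

lemma grad_v_pd: "grad_v m z $ i = pd (0, axis i 1) m z"
  by (simp add: grad_v_def pd_def)

lemma grad_v_sum_Basis: "grad_v m z = (\<Sum>b\<in>Basis. pd b m z *\<^sub>R snd b)"
  by (simp add: vec_eq_iff sum_Basis_phase grad_v_pd sum_3 axis_def forall_3)

lemma grad_x_sum_Basis: "grad_x m z = (\<Sum>b\<in>Basis. pd b m z *\<^sub>R fst b)"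
  by (simp add: vec_eq_iff sum_Basis_phase grad_x_pd sum_3 axis_def forall_3)

lemma cross_grad_v:
  "cross3 (grad_v m z) (grad_v n z)
     = (\<Sum>a\<in>Basis. \<Sum>b\<in>Basis. (pd a m z * pd b n z) *\<^sub>R cross3 (snd a) (snd b))"
proof -
  interpret bounded_bilinear cross3 by (rule bilinear_conv_bounded_bilinear[THEN iffD1, OF bilinear_cross])
  show ?thesis
    unfolding grad_v_sum_Basis sum_left by (simp add: sum_right scaleR_left scaleR_right scaleR_sum_right mult_ac)
qed

lemma poisson_bracket_eq:
  "poisson_bracket B m n z
     = canonical_bracket m n z + B (fst z) \<bullet> cross3 (grad_v m z) (grad_v n z)"
proof -
  have xv: "grad_x m z \<bullet> grad_v n z
      = (\<Sum>a\<in>Basis. \<Sum>b\<in>Basis. fst a \<bullet> snd b * (pd a m z * pd b n z))"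
    unfolding grad_x_sum_Basis grad_v_sum_Basis inner_sum_left
    by (simp add: inner_sum_right sum_distrib_left mult_ac)
  have vx: "grad_v m z \<bullet> grad_x n z
      = (\<Sum>a\<in>Basis. \<Sum>b\<in>Basis. snd a \<bullet> fst b * (pd a m z * pd b n z))"
    unfolding grad_x_sum_Basis grad_v_sum_Basis inner_sum_left
    by (simp add: inner_sum_right sum_distrib_left mult_ac)
  have "B (fst z) \<bullet> cross3 (grad_v m z) (grad_v n z)
      = (\<Sum>a\<in>Basis. \<Sum>b\<in>Basis. B (fst z) \<bullet> cross3 (snd a) (snd b) * (pd a m z * pd b n z))"
    by (simp add: cross_grad_v inner_sum_right mult_ac)
  with xv vx show ?thesis
    by (simp add: poisson_bracket_def canonical_bracket_def poisson_tensor_def distrib_right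
        left_diff_distrib sum.distrib sum_subtractf)
qed

text \<open>The left-hand side is an alternating trilinear form in \<open>u\<close>, \<open>v\<close>, \<open>w\<close>, hence a multiple of the
  determinant, and the factor is the trace of \<open>L\<close>. With \<open>L\<close> the derivative of \<open>B\<close>, this is where
  the field being divergence free enters.\<close>

lemma trace_free_cyclic:
  fixes L :: "real^3 \<Rightarrow> real^3"
  assumes L: "linear L" and tr: "(\<Sum>i\<in>UNIV. L (axis i 1) $ i) = 0"
  shows "L w \<bullet> cross3 u v + L u \<bullet> cross3 v w + L v \<bullet> cross3 w u = 0"
proof -
  have e: "L p $ j = p $ 1 * L (axis 1 1) $ j + p $ 2 * L (axis 2 1) $ j + p $ 3 * L (axis 3 1) $ j" for p j
  proof -
    have "L p = L (\<Sum>i\<in>UNIV. p $ i *\<^sub>R axis i 1)"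
      using basis_expansion[of p] by (simp add: scalar_mult_eq_scaleR)
    also have "\<dots> = (\<Sum>i\<in>UNIV. p $ i *\<^sub>R L (axis i 1))"
      using L by (simp add: linear_sum linear_cmul)
    finally have "L p = p $ 1 *\<^sub>R L (axis 1 1) + p $ 2 *\<^sub>R L (axis 2 1) + p $ 3 *\<^sub>R L (axis 3 1)"
      by (simp add: sum_3)
    then show ?thesis by simp
  qed
  have t: "L (axis 3 1) $ 3 = - L (axis 1 1) $ 1 - L (axis 2 1) $ 2"
    using tr by (simp add: sum_3)
  show ?thesis
    unfolding inner_vec_def sum_3 cross3_def
    by (simp add: e[of w] e[of u] e[of v] t algebra_simps)
qed

section \<open>Phase spaces with a magnetic field\<close>

locale magnetic_phase_space = phase_space_classes \<Omega>x \<Omega>v V U W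
  for \<Omega>x \<Omega>v :: "(real^3) set" and V U W :: "phase_fun set" +
  fixes B :: "real^3 \<Rightarrow> real^3"
  assumes B_smooth: "smooth_on \<Omega>x B"
    and B_class: "\<And>i. (\<lambda>z. B (fst z) $ i) \<in> W"
begin

abbreviation "\<Omega> \<equiv> \<Omega>x \<times> \<Omega>v"

abbreviation "\<pi> \<equiv> poisson_tensor B"

abbreviation pb :: "phase_fun \<Rightarrow> phase_fun \<Rightarrow> phase_fun" where "pb \<equiv> poisson_bracket B"

lemma open_\<Omega>: "open \<Omega>"
  by (intro open_Times open_x open_v)

text \<open>The structure common to \<open>V\<close>, \<open>U\<close> and \<open>W\<close>; membership of brackets in each of them is proved once
  for all three.\<close>

definition W_module :: "phase_fun set \<Rightarrow> bool" where
  "W_module X \<longleftrightarrow> (\<lambda>z. 0) \<in> X \<and> (\<forall>f\<in>X. \<forall>g\<in>X. (\<lambda>z. f z + g z) \<in> X) \<and>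
     (\<forall>f\<in>X. \<forall>c. (\<lambda>z. c * f z) \<in> X) \<and> (\<forall>w\<in>W. \<forall>f\<in>X. (\<lambda>z. w z * f z) \<in> X)"

lemma W_module_W: "W_module W"
  using W_scale[OF B_class, of 0] by (auto simp: W_module_def intro: W_add W_scale W_mult)

lemma zero_V: "(\<lambda>z. 0) \<in> V"
proof -
  have "Ck_on k UNIV (\<lambda>z::phase. 0::real)" for k
    by (induction k) auto
  then have "(\<lambda>z. 0) \<in> test_functions \<Omega>"
    by (auto simp: test_functions_def smooth_on_def intro!: exI[of _ "{}"])
  then show ?thesis using test_functions_subset_V by auto
qed

lemma W_module_V: "W_module V"
  using zero_V by (auto simp: W_module_def intro: V_add V_scale V_mult)

lemma W_module_U: "W_module U"
  using zero_V V_subset_U by (auto simp: W_module_def intro: U_add U_scale U_mult)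

lemma module_sum:
  assumes "W_module X" "finite A" "\<And>i. i \<in> A \<Longrightarrow> f i \<in> X"
  shows "(\<lambda>z. \<Sum>i\<in>A. f i z) \<in> X"
  using assms(2,3)
proof (induction A rule: finite_induct)
  case empty
  then show ?case using assms(1) by (simp add: W_module_def)
next
  case (insert i A)
  then show ?case using assms(1) by (simp add: W_module_def)
qed

text \<open>The canonical part of the tensor is handled by scaling rather than by multiplication with a
  function of \<open>W\<close>, because \<open>W\<close> is not assumed to contain the constant functions. The field \<open>C\<close> is
  arbitrary, so that the canonical bracket is covered as the case \<open>C = 0\<close>.\<close>

lemma module_tensor:
  assumes C: "\<And>i. (\<lambda>z. C (fst z) $ i) \<in> W" and X: "W_module X" and u: "u \<in> X"
  shows "(\<lambda>z. poisson_tensor C a b z * u z) \<in> X"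
proof -
  have "(\<lambda>z. \<Sum>i\<in>UNIV. C (fst z) $ i * (cross3 (snd a) (snd b) $ i * u z)) \<in> X"
    using X u C by (intro module_sum) (auto simp: W_module_def)
  then have "(\<lambda>z. (fst a \<bullet> snd b - snd a \<bullet> fst b) * u z
      + (\<Sum>i\<in>UNIV. C (fst z) $ i * (cross3 (snd a) (snd b) $ i * u z))) \<in> X"
    using X u by (simp add: W_module_def)
  moreover have "(fst a \<bullet> snd b - snd a \<bullet> fst b) * u z
      + (\<Sum>i\<in>UNIV. C (fst z) $ i * (cross3 (snd a) (snd b) $ i * u z))
      = poisson_tensor C a b z * u z" for z
    by (simp add: poisson_tensor_def inner_vec_def distrib_right sum_distrib_right mult.assoc)
  ultimately show ?thesis by simp
qed

lemma module_bracket: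
  assumes C: "\<And>i. (\<lambda>z. C (fst z) $ i) \<in> W" and X: "W_module X"
    and mn: "\<And>a b. a \<in> Basis \<Longrightarrow> b \<in> Basis \<Longrightarrow> (\<lambda>z. pd a m z * pd b n z) \<in> X"
  shows "poisson_bracket C m n \<in> X"
proof -
  have "(\<lambda>z. \<Sum>a\<in>Basis. \<Sum>b\<in>Basis. poisson_tensor C a b z * (pd a m z * pd b n z)) \<in> X"
    by (intro module_sum X finite_Basis module_tensor C mn)
  then show ?thesis by (simp add: poisson_bracket_def[abs_def])
qed

lemma pd_W: "w \<in> W \<Longrightarrow> b \<in> Basis \<Longrightarrow> pd b w \<in> W"
  using W_deriv by (simp add: pd_def[abs_def])

lemma pd_V: "f \<in> V \<Longrightarrow> b \<in> Basis \<Longrightarrow> pd b f \<in> U"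
  using V_deriv by (simp add: pd_def[abs_def])

lemma bracket_W:
  assumes "\<And>i. (\<lambda>z. C (fst z) $ i) \<in> W" "m \<in> W" "n \<in> W"
  shows "poisson_bracket C m n \<in> W"
  using assms by (intro module_bracket W_module_W W_mult pd_W)

lemmas pb_W = bracket_W[OF B_class]

lemma bracket_V:
  assumes "\<And>i. (\<lambda>z. C (fst z) $ i) \<in> W" "f \<in> V" "m \<in> W" "n \<in> W"
  shows "(\<lambda>z. f z * poisson_bracket C m n z) \<in> V"
  using V_mult[OF bracket_W[OF assms(1,3,4)] assms(2)] by (simp add: mult.commute)

lemmas pb_V = bracket_V[OF B_class]

lemma pb_U: "m \<in> W \<Longrightarrow> f \<in> V \<Longrightarrow> pb m f \<in> U"
  by (intro module_bracket W_module_U B_class U_mult pd_W pd_V)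

lemma pb_U': "m \<in> W \<Longrightarrow> f \<in> V \<Longrightarrow> pb f m \<in> U"
  using U_scale[OF pb_U, of m f "-1"] poisson_bracket_antisym[of B m f] by (simp add: fun_eq_iff[symmetric])

lemma V_integrable: "f \<in> V \<Longrightarrow> set_integrable lborel \<Omega> f"
  using U_integrable V_subset_U by auto

lemma smooth_differentiable: "smooth_on S m \<Longrightarrow> z \<in> S \<Longrightarrow> m differentiable (at z)"
  by (auto simp: smooth_on_def dest!: spec[of _ "Suc 0"])

lemma W_differentiable: "w \<in> W \<Longrightarrow> z \<in> \<Omega> \<Longrightarrow> w differentiable (at z)"
  by (rule smooth_differentiable[OF W_smooth])

lemma V_differentiable: "w \<in> V \<Longrightarrow> z \<in> \<Omega> \<Longrightarrow> w differentiable (at z)"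
  by (rule smooth_differentiable[OF V_smooth])

lemma W_continuous: "w \<in> W \<Longrightarrow> continuous_on \<Omega> w"
  using W_smooth[of w] Ck_on.simps(1) unfolding smooth_on_def by blast

lemma W_pd_commute:
  assumes "w \<in> W" "a \<in> Basis" "b \<in> Basis" "z \<in> \<Omega>"
  shows "pd a (pd b w) z = pd b (pd a w) z"
  using assms
  by (intro pd_commute[OF open_\<Omega>] W_differentiable pd_W
      continuous_on_interior[OF W_continuous])
    (auto simp: interior_open[OF open_\<Omega>])

lemma tensor_has_derivative:
  assumes "z \<in> \<Omega>"
  shows "(\<pi> a b has_derivative
    (\<lambda>x. frechet_derivative B (at (fst z)) (fst x) \<bullet> cross3 (snd a) (snd b))) (at z)"
proof -
  have "B differentiable (at (fst z))"
    using assms by (intro smooth_differentiable[OF B_smooth]) auto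
  then have "(B has_derivative frechet_derivative B (at (fst z))) (at (fst z))"
    by (simp add: frechet_derivative_works)
  then have "((\<lambda>z. B (fst z)) has_derivative (\<lambda>x. frechet_derivative B (at (fst z)) (fst x))) (at z)"
    by (rule has_derivative_compose[OF has_derivative_fst[OF has_derivative_ident]])
  then show ?thesis
    unfolding poisson_tensor_def[abs_def] by (auto intro!: derivative_eq_intros)
qed

lemma pd_tensor:
  assumes "z \<in> \<Omega>"
  shows "pd c (\<pi> a b) z = frechet_derivative B (at (fst z)) (fst c) \<bullet> cross3 (snd a) (snd b)"
  using pd_has_derivative[OF tensor_has_derivative[OF assms]] .

lemma tensor_differentiable: "z \<in> \<Omega> \<Longrightarrow> \<pi> a b differentiable (at z)"
  using tensor_has_derivative unfolding differentiable_def by blast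

lemma linear_frechet_B: "z \<in> \<Omega> \<Longrightarrow> linear (frechet_derivative B (at (fst z)))"
  by (intro linear_frechet_derivative smooth_differentiable[OF B_smooth]) auto

text \<open>In a position direction \<open>a\<close> the magnetic part of \<open>\<pi> a b\<close> vanishes because \<open>snd a = 0\<close>; in a
  velocity direction the tensor is constant.\<close>

lemma tensor_unimodular:
  assumes "z \<in> \<Omega>" "a \<in> Basis"
  shows "pd a (\<pi> a b) z = 0"
  using assms(2) linear_0[OF linear_frechet_B[OF assms(1)]]
  by (auto simp: pd_tensor[OF assms(1)] Basis_prod_def)

lemma pb_cong:
  assumes "\<And>y. y \<in> \<Omega> \<Longrightarrow> m y = m' y" "\<And>y. y \<in> \<Omega> \<Longrightarrow> n y = n' y" "z \<in> \<Omega>"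
  shows "poisson_bracket C m n z = poisson_bracket C m' n' z"
  unfolding poisson_bracket_def
  by (intro sum.cong refl arg_cong2[where f = times] pd_cong[OF open_\<Omega> assms(3)] assms)

lemma pb_add_left:
  assumes "m differentiable (at z)" "m' differentiable (at z)"
  shows "poisson_bracket C (\<lambda>y. m y + m' y) n z = poisson_bracket C m n z + poisson_bracket C m' n z"
  by (simp add: poisson_bracket_hamiltonian_right pd_add assms distrib_right sum.distrib)

lemma pb_scale_left:
  assumes "m differentiable (at z)"
  shows "poisson_bracket C (\<lambda>y. c * m y) n z = c * poisson_bracket C m n z"
  by (simp add: poisson_bracket_hamiltonian_right pd_scale assms sum_distrib_left mult.assoc)

lemma pb_add_right:
  assumes "n differentiable (at z)" "n' differentiable (at z)"
  shows "poisson_bracket C m (\<lambda>y. n y + n' y) z = poisson_bracket C m n z + poisson_bracket C m n' z"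
  using pb_add_left[OF assms, of C m] by (simp add: poisson_bracket_antisym[of C m])

lemma pb_scale_right:
  assumes "n differentiable (at z)"
  shows "poisson_bracket C m (\<lambda>y. c * n y) z = c * poisson_bracket C m n z"
  using pb_scale_left[OF assms, of C c m] by (simp add: poisson_bracket_antisym[of C m])

lemma pb_leibniz:
  assumes "u differentiable (at z)" "w differentiable (at z)"
  shows "pb (\<lambda>y. u y * w y) h z = u z * pb w h z + w z * pb u h z"
  by (simp add: poisson_bracket_hamiltonian_right pd_mult assms sum.distrib[symmetric]
      sum_distrib_left algebra_simps)

section \<open>Integration by parts\<close>

text \<open>Expanding the right-hand side by the product rule leaves \<open>[u, h]\<close> and two sums that vanish: one
  is the divergence of \<open>\<pi>\<close>, the other contracts the antisymmetric \<open>\<pi>\<close> with the symmetric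
  Hessian of \<open>h\<close>. Each function differentiated on the right lies in \<open>V\<close>, so it has no boundary
  term.\<close>

lemma pb_total_derivative:
  assumes u: "u \<in> V" and h: "h \<in> W" and z: "z \<in> \<Omega>"
  shows "pb u h z = (\<Sum>a\<in>Basis. \<Sum>b\<in>Basis. pd a (\<lambda>y. \<pi> a b y * (pd b h y * u y)) z)"
proof -
  have pd: "pd a (\<lambda>y. \<pi> a b y * (pd b h y * u y)) z
      = \<pi> a b z * (pd a u z * pd b h z) + u z * (\<pi> a b z * pd a (pd b h) z)"
    if "a \<in> Basis" "b \<in> Basis" for a b
    using that u h z
    by (simp add: pd_mult tensor_differentiable V_differentiable W_differentiable pd_W
        tensor_unimodular differentiable_mult algebra_simps)
  have "(\<Sum>a\<in>Basis. \<Sum>b\<in>Basis. \<pi> a b z * pd a (pd b h) z)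
      = (\<Sum>a\<in>Basis. \<Sum>b\<in>Basis. \<pi> b a z * pd b (pd a h) z)"
    by (rule sum.swap)
  also have "\<dots> = (\<Sum>a\<in>Basis. \<Sum>b\<in>Basis. - (\<pi> a b z * pd a (pd b h) z))"
  proof (intro sum.cong refl)
    fix a b :: phase assume "a \<in> Basis" "b \<in> Basis"
    then show "\<pi> b a z * pd b (pd a h) z = - (\<pi> a b z * pd a (pd b h) z)"
      using poisson_tensor_antisym[of B b a z] W_pd_commute[OF h, of a b z] z by simp
  qed
  finally have "(\<Sum>a\<in>Basis. \<Sum>b\<in>Basis. \<pi> a b z * pd a (pd b h) z) = 0"
    by (simp add: sum_negf)
  then have zero: "(\<Sum>a\<in>Basis. \<Sum>b\<in>Basis. u z * (\<pi> a b z * pd a (pd b h) z)) = 0"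
    by (simp add: sum_distrib_left[symmetric])
  have "(\<Sum>a\<in>Basis. \<Sum>b\<in>Basis. pd a (\<lambda>y. \<pi> a b y * (pd b h y * u y)) z)
      = (\<Sum>a\<in>Basis. \<Sum>b\<in>Basis. \<pi> a b z * (pd a u z * pd b h z) + u z * (\<pi> a b z * pd a (pd b h) z))"
    using pd by (intro sum.cong refl) auto
  then show ?thesis
    by (simp add: sum.distrib zero poisson_bracket_def)
qed

lemma LINT_cong:
  assumes "\<And>z. z \<in> \<Omega> \<Longrightarrow> k z = l z"
  shows "(LINT z:\<Omega>|lborel. k z) = (LINT z:\<Omega>|lborel. l z)"
  using assms open_\<Omega> by (intro set_lebesgue_integral_cong) auto

lemma set_integrable_sum:
  fixes k :: "'i \<Rightarrow> phase_fun"
  assumes "\<And>i. i \<in> A \<Longrightarrow> set_integrable lborel \<Omega> (k i)"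
  shows "set_integrable lborel \<Omega> (\<lambda>z. \<Sum>i\<in>A. k i z)"
  using assms unfolding set_integrable_def scaleR_sum_right
  by (rule Bochner_Integration.integrable_sum)

lemma LINT_sum:
  fixes k :: "'i \<Rightarrow> phase_fun"
  assumes "\<And>i. i \<in> A \<Longrightarrow> set_integrable lborel \<Omega> (k i)"
  shows "(LINT z:\<Omega>|lborel. (\<Sum>i\<in>A. k i z)) = (\<Sum>i\<in>A. LINT z:\<Omega>|lborel. k i z)"
  using assms unfolding set_lebesgue_integral_def set_integrable_def scaleR_sum_right
  by (rule Bochner_Integration.integral_sum)

lemma LINT_bracket_zero:
  assumes u: "u \<in> V" and h: "h \<in> W"
  shows "(LINT z:\<Omega>|lborel. pb u h z) = 0"
proof -
  let ?t = "\<lambda>a b z. \<pi> a b z * (pd b h z * u z)"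
  have tV: "?t a b \<in> V" if "b \<in> Basis" for a b
    using that by (intro module_tensor B_class W_module_V V_mult pd_W u h)
  have int: "set_integrable lborel \<Omega> (pd a (?t a b))" if "a \<in> Basis" "b \<in> Basis" for a b
    using that by (intro U_integrable pd_V tV)
  have "(LINT z:\<Omega>|lborel. pb u h z)
      = (LINT z:\<Omega>|lborel. (\<Sum>a\<in>Basis. \<Sum>b\<in>Basis. pd a (?t a b) z))"
    by (intro LINT_cong pb_total_derivative u h)
  also have "\<dots> = (\<Sum>a\<in>Basis. \<Sum>b\<in>Basis. LINT z:\<Omega>|lborel. pd a (?t a b) z)"
    using int by (simp add: LINT_sum set_integrable_sum)
  also have "\<dots> = 0"
    using no_boundary_term[OF tV] by (simp add: pd_def)
  finally show ?thesis .
qed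

text \<open>Integrate \<open>[u w, h] = u [w, h] + w [u, h]\<close>.\<close>

lemma bracket_by_parts:
  assumes u: "u \<in> V" and w: "w \<in> W" and h: "h \<in> W"
  shows "(LINT z:\<Omega>|lborel. u z * pb w h z) = (LINT z:\<Omega>|lborel. w z * pb h u z)"
proof -
  have i1: "set_integrable lborel \<Omega> (\<lambda>z. u z * pb w h z)"
    by (intro V_integrable pb_V u w h)
  have i2: "set_integrable lborel \<Omega> (\<lambda>z. w z * pb h u z)"
    by (intro U_integrable U_mult pb_U u w h)
  have "(\<lambda>z. u z * w z) \<in> V" using V_mult[OF w u] by (simp add: mult.commute)
  from LINT_bracket_zero[OF this h]
  have "(LINT z:\<Omega>|lborel. u z * pb w h z - w z * pb h u z) = 0"
  proof (rule trans[rotated], intro LINT_cong)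
    fix z assume "z \<in> \<Omega>"
    then show "u z * pb w h z - w z * pb h u z = pb (\<lambda>z. u z * w z) h z"
      using pb_leibniz[OF V_differentiable[OF u] W_differentiable[OF w], of z h]
      by (simp add: poisson_bracket_antisym[of B h u])
  qed
  with i1 i2 show ?thesis by simp
qed

section \<open>The pointwise Jacobi identity\<close>

text \<open>The Hessian of \<open>p\<close> applied to the Hamiltonian fields of \<open>m\<close> and \<open>n\<close>. All second derivatives in
  a double bracket have this form, and its symmetry is what makes them cancel in the Jacobi sum.\<close>

definition hessian_form :: "phase_fun \<Rightarrow> phase_fun \<Rightarrow> phase_fun \<Rightarrow> phase_fun" where
  "hessian_form p m n z =
     (\<Sum>a\<in>Basis. \<Sum>c\<in>Basis. pd c (pd a p) z * hamiltonian_field B m a z * hamiltonian_field B n c z)"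

lemma hessian_form_sym:
  assumes "p \<in> W" "z \<in> \<Omega>"
  shows "hessian_form p m n z = hessian_form p n m z"
proof -
  have "hessian_form p m n z = (\<Sum>a\<in>Basis. \<Sum>c\<in>Basis. pd a (pd c p) z * hamiltonian_field B m c z * hamiltonian_field B n a z)"
    unfolding hessian_form_def by (rule sum.swap)
  also have "\<dots> = hessian_form p n m z"
    unfolding hessian_form_def
  proof (intro sum.cong refl)
    fix a c :: phase assume "a \<in> Basis" "c \<in> Basis"
    then show "pd a (pd c p) z * hamiltonian_field B m c z * hamiltonian_field B n a z
        = pd c (pd a p) z * hamiltonian_field B n a z * hamiltonian_field B m c z"
      using W_pd_commute[of p a c z] assms by simp
  qed
  finally show ?thesis .
qed

text \<open>Only the position components of a Hamiltonian field matter for differentiating \<open>B\<close>, and the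
  magnetic part of the tensor does not contribute to them: \<open>dx/dt = \<partial>h/\<partial>v\<close>.\<close>

lemma hamiltonian_field_position:
  "(\<Sum>c\<in>Basis. hamiltonian_field B h c z *\<^sub>R fst c) = grad_v h z"
proof -
  have "hamiltonian_field B h (axis i 1, 0) z = grad_v h z $ i" for i
    by (simp add: hamiltonian_field_def poisson_tensor_def sum_Basis_phase grad_v_pd inner_axis_axis
        if_distrib[of "\<lambda>t. t * _"] sum.delta cong: if_cong)
  then show ?thesis
    by (simp add: sum_Basis_phase vec_eq_iff sum_3 axis_def forall_3)
qed

lemma pd_bracket:
  assumes m: "m \<in> W" and n: "n \<in> W" and z: "z \<in> \<Omega>"
  shows "pd c (pb m n) z =
    frechet_derivative B (at (fst z)) (fst c) \<bullet> cross3 (grad_v m z) (grad_v n z)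
    + (\<Sum>a\<in>Basis. pd c (pd a m) z * hamiltonian_field B n a z)
    - (\<Sum>a\<in>Basis. pd c (pd a n) z * hamiltonian_field B m a z)"
proof -
  let ?DB = "frechet_derivative B (at (fst z)) (fst c)"
  have dW: "w differentiable (at z)" if "w \<in> W" for w using W_differentiable[OF that z] .
  have "pd c (pb m n) z
      = (\<Sum>a\<in>Basis. \<Sum>b\<in>Basis. pd c (\<lambda>y. \<pi> a b y * (pd a m y * pd b n y)) z)"
    unfolding poisson_bracket_def[abs_def]
    using m n z
    by (simp add: pd_sum differentiable_sum differentiable_mult tensor_differentiable dW pd_W)
  also have "\<dots> = (\<Sum>a\<in>Basis. \<Sum>b\<in>Basis.
       ?DB \<bullet> ((pd a m z * pd b n z) *\<^sub>R cross3 (snd a) (snd b))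
       + pd c (pd a m) z * (\<pi> a b z * pd b n z) + \<pi> a b z * (pd a m z * pd c (pd b n) z))"
    using m n z
    by (intro sum.cong refl)
      (simp add: pd_mult differentiable_mult tensor_differentiable dW pd_W pd_tensor algebra_simps)
  also have "\<dots> = ?DB \<bullet> cross3 (grad_v m z) (grad_v n z)
      + (\<Sum>a\<in>Basis. pd c (pd a m) z * hamiltonian_field B n a z)
      + (\<Sum>a\<in>Basis. \<Sum>b\<in>Basis. \<pi> a b z * (pd a m z * pd c (pd b n) z))"
    by (simp add: sum.distrib cross_grad_v inner_sum_right hamiltonian_field_def sum_distrib_left)
  also have "(\<Sum>a\<in>Basis. \<Sum>b\<in>Basis. \<pi> a b z * (pd a m z * pd c (pd b n) z))
      = (\<Sum>b\<in>Basis. \<Sum>a\<in>Basis. \<pi> a b z * (pd a m z * pd c (pd b n) z))"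
    by (rule sum.swap)
  also have "\<dots> = - (\<Sum>b\<in>Basis. pd c (pd b n) z * hamiltonian_field B m b z)"
    unfolding hamiltonian_field_def sum_distrib_left sum_negf[symmetric]
    by (intro sum.cong refl) (subst poisson_tensor_antisym, simp)
  finally show ?thesis by simp
qed

lemma bracket_bracket:
  assumes m: "m \<in> W" and n: "n \<in> W" and z: "z \<in> \<Omega>"
  shows "pb (pb m n) h z =
    frechet_derivative B (at (fst z)) (grad_v h z) \<bullet> cross3 (grad_v m z) (grad_v n z)
    + hessian_form m n h z - hessian_form n m h z"
proof -
  let ?D = "frechet_derivative B (at (fst z))" and ?X = "\<lambda>c. hamiltonian_field B h c z"
  have "?D (grad_v h z) = (\<Sum>c\<in>Basis. ?X c *\<^sub>R ?D (fst c))"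
    using linear_frechet_B[OF z]
    by (simp add: hamiltonian_field_position[symmetric] linear_sum linear_cmul)
  then have D: "?D (grad_v h z) \<bullet> cross3 (grad_v m z) (grad_v n z)
      = (\<Sum>c\<in>Basis. ?D (fst c) \<bullet> cross3 (grad_v m z) (grad_v n z) * ?X c)"
    by (simp add: inner_sum_left mult.commute)
  have H: "(\<Sum>c\<in>Basis. (\<Sum>a\<in>Basis. pd c (pd a p) z * hamiltonian_field B q a z) * ?X c)
      = hessian_form p q h z" for p q
    unfolding hessian_form_def sum_distrib_right by (rule sum.swap)
  show ?thesis
    unfolding poisson_bracket_hamiltonian_right[of B "pb m n"] D H[symmetric] pd_bracket[OF assms]
    by (simp add: distrib_right left_diff_distrib sum.distrib sum_subtractf)
qed

text \<open>Each of \<open>m\<close>, \<open>n\<close>, \<open>h\<close> contributes its Hessian form twice, with the arguments exchanged and opposite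
  signs, so the second derivatives cancel. What remains is the cyclic sum of the derivatives of \<open>B\<close>,
  which vanishes because their trace is the divergence.\<close>

lemma pb_jacobi:
  assumes div: "divergence B (fst z) = 0"
    and W: "m \<in> W" "n \<in> W" "h \<in> W" and z: "z \<in> \<Omega>"
  shows "pb (pb m n) h z + pb (pb n h) m z + pb (pb h m) n z = 0"
proof -
  have "frechet_derivative B (at (fst z)) (grad_v h z) \<bullet> cross3 (grad_v m z) (grad_v n z)
      + frechet_derivative B (at (fst z)) (grad_v m z) \<bullet> cross3 (grad_v n z) (grad_v h z)
      + frechet_derivative B (at (fst z)) (grad_v n z) \<bullet> cross3 (grad_v h z) (grad_v m z) = 0"
    using div by (intro trace_free_cyclic linear_frechet_B z) (simp add: divergence_def)
  then show ?thesis
    unfolding bracket_bracket[OF W(1,2) z] bracket_bracket[OF W(2,3) z] bracket_bracket[OF W(3,1) z]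
    using hessian_form_sym[OF W(1) z, of n h] hessian_form_sym[OF W(2) z, of h m]
      hessian_form_sym[OF W(3) z, of m n]
    by simp
qed

section \<open>Variational derivatives\<close>

abbreviation vd :: "phase_functional \<Rightarrow> phase_fun \<Rightarrow> phase_fun" where
  "vd \<equiv> variational_derivative \<Omega> V"

text \<open>Two variational derivatives have the same integrals against all test functions.\<close>

lemma has_variational_derivative_unique:
  assumes g: "has_variational_derivative \<Omega> V F f g"
    and g': "has_variational_derivative \<Omega> V F f g'" and z: "z \<in> \<Omega>"
  shows "g z = g' z"
proof -
  have test: "set_integrable lborel \<Omega> (\<lambda>z. (g z - g' z) * \<phi> z) \<and> (LINT z:\<Omega>|lborel. (g z - g' z) * \<phi> z) = 0"
    if "\<phi> \<in> test_functions \<Omega>" for \<phi>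
  proof -
    have \<phi>: "\<phi> \<in> V" using that test_functions_subset_V by auto
    have int: "set_integrable lborel \<Omega> (\<lambda>z. g z * \<phi> z)" "set_integrable lborel \<Omega> (\<lambda>z. g' z * \<phi> z)"
      using g g' \<phi> by (auto simp: has_variational_derivative_def)
    have "(LINT z:\<Omega>|lborel. g z * \<phi> z) = (LINT z:\<Omega>|lborel. g' z * \<phi> z)"
    proof (rule tendsto_unique[of "at (0::real)"])
      show "((\<lambda>\<epsilon>. (F (\<lambda>z. f z + \<epsilon> * \<phi> z) - F f) / \<epsilon>) \<longlongrightarrow> (LINT z:\<Omega>|lborel. g z * \<phi> z)) (at 0)"
        using g \<phi> unfolding has_variational_derivative_def by blast
      show "((\<lambda>\<epsilon>. (F (\<lambda>z. f z + \<epsilon> * \<phi> z) - F f) / \<epsilon>) \<longlongrightarrow> (LINT z:\<Omega>|lborel. g' z * \<phi> z)) (at 0)"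
        using g' \<phi> unfolding has_variational_derivative_def by blast
    qed simp
    with int show ?thesis by (simp add: left_diff_distrib)
  qed
  have "continuous_on \<Omega> g" "continuous_on \<Omega> g'"
    using g g' Ck_on.simps(1) unfolding has_variational_derivative_def smooth_on_def by blast+
  then have "continuous_on \<Omega> (\<lambda>z. g z - g' z)" by (intro continuous_on_diff)
  from fundamental_lemma[OF open_\<Omega> this _ _ z] test show ?thesis by auto
qed

text \<open>The function chosen by the definition of \<open>variational_derivative\<close> need only be smooth on the domain.
  By uniqueness it agrees there with the one in \<open>W\<close> that differentiability provides.\<close>

lemma vd_works:
  assumes "variationally_differentiable \<Omega> V W F" "f \<in> V"
  shows has_vd: "has_variational_derivative \<Omega> V F f (vd F f)" and vd_W: "vd F f \<in> W"
proof -
  obtain g where g: "g \<in> W" "has_variational_derivative \<Omega> V F f g"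
    using assms by (auto simp: variationally_differentiable_def)
  show "has_variational_derivative \<Omega> V F f (vd F f)"
    unfolding variational_derivative_def by (rule someI[of _ g], rule g(2))
  from has_variational_derivative_unique[OF this g(2)] show "vd F f \<in> W"
    by (rule W_cong[OF g(1)])
qed

lemma vd_eqI:
  assumes k: "k \<in> W"
    and lim: "\<And>\<phi>. \<phi> \<in> V \<Longrightarrow> ((\<lambda>\<epsilon>::real. (F (\<lambda>z. f z + \<epsilon> * \<phi> z) - F f) / \<epsilon>)
           \<longlongrightarrow> (LINT z:\<Omega>|lborel. k z * \<phi> z)) (at 0)"
    and z: "z \<in> \<Omega>"
  shows "vd F f z = k z"
proof -
  have k: "has_variational_derivative \<Omega> V F f k"
    using k lim V_integrable[OF V_mult] W_smooth by (auto simp: has_variational_derivative_def)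
  show ?thesis
    by (rule has_variational_derivative_unique[OF _ k z])
      (unfold variational_derivative_def, rule someI[of _ k], rule k)
qed

lemma vd_tendsto:
  assumes "variationally_differentiable \<Omega> V W F" "f \<in> V" "\<phi> \<in> V"
  shows "((\<lambda>\<epsilon>::real. (F (\<lambda>z. f z + \<epsilon> * \<phi> z) - F f) / \<epsilon>)
           \<longlongrightarrow> (LINT z:\<Omega>|lborel. vd F f z * \<phi> z)) (at 0)"
  using has_vd[OF assms(1,2)] assms(3) by (auto simp: has_variational_derivative_def)

lemma vd_linear:
  assumes F: "variationally_differentiable \<Omega> V W F" and G: "variationally_differentiable \<Omega> V W G"
    and f: "f \<in> V" and z: "z \<in> \<Omega>"
  shows "vd (\<lambda>h. a * F h + b * G h) f z = a * vd F f z + b * vd G f z"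
proof (rule vd_eqI[OF _ _ z])
  show "(\<lambda>z. a * vd F f z + b * vd G f z) \<in> W"
    by (intro W_add W_scale vd_W F G f)
  fix \<phi> assume \<phi>: "\<phi> \<in> V"
  have int: "set_integrable lborel \<Omega> (\<lambda>z. vd F f z * \<phi> z)" "set_integrable lborel \<Omega> (\<lambda>z. vd G f z * \<phi> z)"
    by (intro V_integrable V_mult vd_W F G f \<phi>)+
  have "((\<lambda>\<epsilon>::real. a * ((F (\<lambda>z. f z + \<epsilon> * \<phi> z) - F f) / \<epsilon>) + b * ((G (\<lambda>z. f z + \<epsilon> * \<phi> z) - G f) / \<epsilon>))
     \<longlongrightarrow> a * (LINT z:\<Omega>|lborel. vd F f z * \<phi> z) + b * (LINT z:\<Omega>|lborel. vd G f z * \<phi> z)) (at 0)"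
    by (intro tendsto_intros vd_tendsto F G f \<phi>)
  moreover have "(LINT z:\<Omega>|lborel. (a * vd F f z + b * vd G f z) * \<phi> z)
      = a * (LINT z:\<Omega>|lborel. vd F f z * \<phi> z) + b * (LINT z:\<Omega>|lborel. vd G f z * \<phi> z)"
    using int by (simp add: distrib_right mult.assoc)
  ultimately show "((\<lambda>\<epsilon>::real. (a * F (\<lambda>z. f z + \<epsilon> * \<phi> z) + b * G (\<lambda>z. f z + \<epsilon> * \<phi> z) - (a * F f + b * G f)) / \<epsilon>)
     \<longlongrightarrow> (LINT z:\<Omega>|lborel. (a * vd F f z + b * vd G f z) * \<phi> z)) (at 0)"
    by (simp add: add_divide_distrib diff_divide_distrib right_diff_distrib algebra_simps)
qed

text \<open>The two integrals of the definition may be merged, since both integrands lie in \<open>V\<close>: the canonical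
  one is the bracket for the zero field, and the magnetic one is a difference.\<close>

lemma magnetic_bracket_eq:
  assumes f: "f \<in> V" and m: "vd F f \<in> W" and n: "vd G f \<in> W"
  shows "magnetic_bracket \<Omega> V B F G f = (LINT z:\<Omega>|lborel. f z * pb (vd F f) (vd G f) z)"
proof -
  let ?can = "\<lambda>z. f z * canonical_bracket (vd F f) (vd G f) z"
  let ?mag = "\<lambda>z. f z * (B (fst z) \<bullet> cross3 (grad_v (vd F f) z) (grad_v (vd G f) z))"
  have can: "?can = (\<lambda>z. f z * poisson_bracket (\<lambda>x. 0) (vd F f) (vd G f) z)"
    by (simp add: poisson_bracket_eq)
  have "(\<lambda>z. 0) \<in> W" using W_module_W by (simp add: W_module_def)
  then have "?can \<in> V" unfolding can by (intro bracket_V f m n) simp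
  moreover have "?mag = (\<lambda>z. f z * pb (vd F f) (vd G f) z + (-1) * ?can z)"
    by (simp add: poisson_bracket_eq algebra_simps)
  then have "?mag \<in> V"
    using V_add[OF pb_V[OF f m n] V_scale[OF \<open>?can \<in> V\<close>, of "-1"]] by simp
  ultimately show ?thesis
    by (simp add: magnetic_bracket_def poisson_bracket_eq distrib_left V_integrable)
qed

section \<open>The first variation of the bracket\<close>

text \<open>The weighted \<open>H\<^sup>1\<close> norm dominates the weighted \<open>L\<^sup>2\<close> norm of each partial derivative.\<close>

lemma weighted_H1_null_pd:
  assumes null: "weighted_H1_null \<Omega> U R" and R: "\<And>\<epsilon>. R \<epsilon> \<in> W"
    and u: "u \<in> U" and a: "a \<in> Basis"
  shows "((\<lambda>\<epsilon>. LINT z:\<Omega>|lborel. \<bar>u z\<bar> * (pd a (R \<epsilon>) z)\<^sup>2) \<longlongrightarrow> 0) (at 0)"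
    and "\<And>\<epsilon>. set_integrable lborel \<Omega> (\<lambda>z. \<bar>u z\<bar> * (pd a (R \<epsilon>) z)\<^sup>2)"
proof -
  let ?e = "\<lambda>\<epsilon> z. (R \<epsilon> z)\<^sup>2 + (\<Sum>c\<in>Basis. (pd c (R \<epsilon>) z)\<^sup>2)"
  have e: "(R \<epsilon> z)\<^sup>2 + (norm (grad_x (R \<epsilon>) z))\<^sup>2 + (norm (grad_v (R \<epsilon>) z))\<^sup>2 = ?e \<epsilon> z" for \<epsilon> z
    unfolding power2_norm_eq_inner by (simp add: inner_vec_def grad_x_pd grad_v_pd sum_Basis_phase power2_eq_square)
  have int_abs: "set_integrable lborel \<Omega> (\<lambda>z. \<bar>u z\<bar> * w z)" if "w \<in> W" "\<And>z. w z \<ge> 0" for w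
    using set_integrable_abs[OF U_integrable[OF U_mult[OF that(1) u]]] that(2)
    by (simp add: abs_mult mult.commute)
  show int: "set_integrable lborel \<Omega> (\<lambda>z. \<bar>u z\<bar> * (pd a (R \<epsilon>) z)\<^sup>2)" for \<epsilon>
    unfolding power2_eq_square by (intro int_abs W_mult pd_W R a) simp
  have "?e \<epsilon> \<in> W" for \<epsilon>
    unfolding power2_eq_square by (intro W_add module_sum W_module_W W_mult pd_W R) auto
  then have int_e: "set_integrable lborel \<Omega> (\<lambda>z. \<bar>u z\<bar> * ?e \<epsilon> z)" for \<epsilon>
    by (intro int_abs) (auto intro!: add_nonneg_nonneg sum_nonneg)
  have lim: "((\<lambda>\<epsilon>. LINT z:\<Omega>|lborel. \<bar>u z\<bar> * ?e \<epsilon> z) \<longlongrightarrow> 0) (at 0)"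
    using null u unfolding weighted_H1_null_def e by blast
  have "(LINT z:\<Omega>|lborel. \<bar>u z\<bar> * (pd a (R \<epsilon>) z)\<^sup>2) \<le> (LINT z:\<Omega>|lborel. \<bar>u z\<bar> * ?e \<epsilon> z)" for \<epsilon>
  proof (rule set_integral_mono[OF int int_e])
    fix z
    have "(pd a (R \<epsilon>) z)\<^sup>2 \<le> (\<Sum>c\<in>Basis. (pd c (R \<epsilon>) z)\<^sup>2)"
      using a by (intro member_le_sum) auto
    then show "\<bar>u z\<bar> * (pd a (R \<epsilon>) z)\<^sup>2 \<le> \<bar>u z\<bar> * ?e \<epsilon> z"
      by (intro mult_left_mono) (auto intro: add_increasing)
  qed
  moreover have "0 \<le> (LINT z:\<Omega>|lborel. \<bar>u z\<bar> * (pd a (R \<epsilon>) z)\<^sup>2)" for \<epsilon>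
    unfolding set_lebesgue_integral_def by (intro Bochner_Integration.integral_nonneg) simp
  ultimately show "((\<lambda>\<epsilon>. LINT z:\<Omega>|lborel. \<bar>u z\<bar> * (pd a (R \<epsilon>) z)\<^sup>2) \<longlongrightarrow> 0) (at 0)"
    by (intro tendsto_sandwich[OF _ _ tendsto_const lim]) auto
qed

lemma abs_LINT_le:
  fixes k l :: phase_fun
  assumes "set_integrable lborel \<Omega> k" "set_integrable lborel \<Omega> l" "\<And>z. \<bar>k z\<bar> \<le> l z"
  shows "\<bar>LINT z:\<Omega>|lborel. k z\<bar> \<le> (LINT z:\<Omega>|lborel. l z)"
proof -
  have "(LINT z:\<Omega>|lborel. k z) \<le> (LINT z:\<Omega>|lborel. l z)"
    by (intro set_integral_mono assms) (use assms(3) abs_le_D1 in blast)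
  moreover have "- (LINT z:\<Omega>|lborel. k z) \<le> (LINT z:\<Omega>|lborel. l z)"
    using assms(1)
    by (subst set_integral_uminus[symmetric], simp, intro set_integral_mono)
      (use assms abs_le_D2 in \<open>auto simp: set_integrable_def\<close>)
  ultimately show ?thesis by simp
qed

text \<open>This is the Cauchy-Schwarz inequality with weight \<open>\<bar>u\<bar>\<close>, obtained from the pointwise bound
  \<open>\<bar>x\<bar> \<le> \<delta> + x\<^sup>2 / \<delta>\<close>. The integral is at most \<open>\<delta> * I + N / \<delta>\<close>, where \<open>I\<close> is the total weight
  and \<open>N\<close> the weighted square norm of the derivative; \<open>\<delta>\<close> of the order of \<open>sqrt N\<close> is the
  right choice.\<close>

lemma null_linear:
  assumes null: "weighted_H1_null \<Omega> U R" and R: "\<And>\<epsilon>. R \<epsilon> \<in> W"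
    and u: "u \<in> U" and a: "a \<in> Basis"
  shows "((\<lambda>\<epsilon>. LINT z:\<Omega>|lborel. u z * pd a (R \<epsilon>) z) \<longlongrightarrow> 0) (at 0)"
proof -
  define N where "N \<epsilon> = (LINT z:\<Omega>|lborel. \<bar>u z\<bar> * (pd a (R \<epsilon>) z)\<^sup>2)" for \<epsilon>
  define I where "I = (LINT z:\<Omega>|lborel. \<bar>u z\<bar>)"
  \<comment> \<open>the summand \<open>\<bar>\<epsilon>\<bar>\<close> keeps \<open>\<delta>\<close> positive where \<open>N\<close> vanishes\<close>
  define \<delta> where "\<delta> \<epsilon> = \<bar>\<epsilon>\<bar> + sqrt (N \<epsilon>)" for \<epsilon>
  have N: "(N \<longlongrightarrow> 0) (at 0)" and int: "\<And>\<epsilon>. set_integrable lborel \<Omega> (\<lambda>z. \<bar>u z\<bar> * (pd a (R \<epsilon>) z)\<^sup>2)"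
    unfolding N_def[abs_def] using weighted_H1_null_pd[OF assms] by auto
  have N0: "N \<epsilon> \<ge> 0" for \<epsilon>
    unfolding N_def set_lebesgue_integral_def by (intro Bochner_Integration.integral_nonneg) simp
  have intu: "set_integrable lborel \<Omega> (\<lambda>z. \<bar>u z\<bar>)" by (intro set_integrable_abs U_integrable u)
  have bound: "\<bar>LINT z:\<Omega>|lborel. u z * pd a (R \<epsilon>) z\<bar> \<le> \<delta> \<epsilon> * I + sqrt (N \<epsilon>)" if "\<epsilon> \<noteq> 0" for \<epsilon>
  proof -
    have \<delta>: "\<delta> \<epsilon> > 0" using that N0 by (simp add: \<delta>_def add_pos_nonneg)
    have "\<bar>LINT z:\<Omega>|lborel. u z * pd a (R \<epsilon>) z\<bar>
        \<le> (LINT z:\<Omega>|lborel. \<delta> \<epsilon> * \<bar>u z\<bar> + \<bar>u z\<bar> * (pd a (R \<epsilon>) z)\<^sup>2 / \<delta> \<epsilon>)"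
    proof (rule abs_LINT_le)
      show "set_integrable lborel \<Omega> (\<lambda>z. u z * pd a (R \<epsilon>) z)"
        using U_integrable[OF U_mult[OF pd_W[OF R a] u]] by (simp add: mult.commute)
      show "set_integrable lborel \<Omega> (\<lambda>z. \<delta> \<epsilon> * \<bar>u z\<bar> + \<bar>u z\<bar> * (pd a (R \<epsilon>) z)\<^sup>2 / \<delta> \<epsilon>)"
        by (intro set_integral_add set_integrable_mult_right set_integrable_divide intu int)
      fix z
      let ?x = "pd a (R \<epsilon>) z"
      have "\<bar>?x\<bar> \<le> \<delta> \<epsilon> + ?x\<^sup>2 / \<delta> \<epsilon>"
      proof -
        have "\<bar>?x\<bar> * \<delta> \<epsilon> \<le> (\<delta> \<epsilon>)\<^sup>2 + \<bar>?x\<bar>\<^sup>2"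
          using sum_squares_bound[of "\<bar>?x\<bar>" "\<delta> \<epsilon>"]
            mult_nonneg_nonneg[OF abs_ge_zero less_imp_le[OF \<delta>], of ?x] by simp
        then have "\<bar>?x\<bar> \<le> ((\<delta> \<epsilon>)\<^sup>2 + ?x\<^sup>2) / \<delta> \<epsilon>" using \<delta> by (simp add: le_divide_eq)
        then show ?thesis using \<delta> by (simp add: add_divide_distrib power2_eq_square)
      qed
      from mult_left_mono[OF this, of "\<bar>u z\<bar>"]
      show "\<bar>u z * ?x\<bar> \<le> \<delta> \<epsilon> * \<bar>u z\<bar> + \<bar>u z\<bar> * ?x\<^sup>2 / \<delta> \<epsilon>"
        by (simp add: abs_mult algebra_simps)
    qed
    also have "\<dots> = \<delta> \<epsilon> * I + N \<epsilon> / \<delta> \<epsilon>"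
      using int[of \<epsilon>] intu by (simp add: I_def N_def)
    also have "N \<epsilon> / \<delta> \<epsilon> \<le> sqrt (N \<epsilon>)"
    proof -
      have "N \<epsilon> = sqrt (N \<epsilon>) * sqrt (N \<epsilon>)" using N0[of \<epsilon>] by simp
      also have "\<dots> \<le> sqrt (N \<epsilon>) * \<delta> \<epsilon>" using N0[of \<epsilon>] by (intro mult_left_mono) (auto simp: \<delta>_def)
      finally show ?thesis using \<delta> by (simp add: divide_le_eq)
    qed
    finally show ?thesis by simp
  qed
  have "((\<lambda>\<epsilon>. \<delta> \<epsilon> * I + sqrt (N \<epsilon>)) \<longlongrightarrow> (\<bar>0\<bar> + sqrt 0) * I + sqrt 0) (at 0)"
    unfolding \<delta>_def by (intro tendsto_intros N)
  then have "((\<lambda>\<epsilon>. \<delta> \<epsilon> * I + sqrt (N \<epsilon>)) \<longlongrightarrow> 0) (at 0)" by simp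
  then show ?thesis
    by (rule Lim_null_comparison[rotated]) (use bound in \<open>auto simp: eventually_at_filter\<close>)
qed

lemma null_bilinear:
  assumes R: "weighted_H1_null \<Omega> U R" "\<And>\<epsilon>. R \<epsilon> \<in> W"
    and Q: "weighted_H1_null \<Omega> U Q" "\<And>\<epsilon>. Q \<epsilon> \<in> W"
    and u: "u \<in> U" and ab: "a \<in> Basis" "b \<in> Basis"
  shows "((\<lambda>\<epsilon>. LINT z:\<Omega>|lborel. u z * (pd a (R \<epsilon>) z * pd b (Q \<epsilon>) z)) \<longlongrightarrow> 0) (at 0)"
proof (rule Lim_null_comparison)
  note r = weighted_H1_null_pd[OF R u ab(1)] and q = weighted_H1_null_pd[OF Q u ab(2)]
  show "((\<lambda>\<epsilon>. (LINT z:\<Omega>|lborel. \<bar>u z\<bar> * (pd a (R \<epsilon>) z)\<^sup>2) + (LINT z:\<Omega>|lborel. \<bar>u z\<bar> * (pd b (Q \<epsilon>) z)\<^sup>2))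
      \<longlongrightarrow> 0) (at 0)"
    using tendsto_add[OF r(1) q(1)] by simp
  have "\<bar>LINT z:\<Omega>|lborel. u z * (pd a (R \<epsilon>) z * pd b (Q \<epsilon>) z)\<bar>
      \<le> (LINT z:\<Omega>|lborel. \<bar>u z\<bar> * (pd a (R \<epsilon>) z)\<^sup>2 + \<bar>u z\<bar> * (pd b (Q \<epsilon>) z)\<^sup>2)" for \<epsilon>
  proof (rule abs_LINT_le)
    show "set_integrable lborel \<Omega> (\<lambda>z. u z * (pd a (R \<epsilon>) z * pd b (Q \<epsilon>) z))"
      using U_integrable[OF U_mult[OF W_mult[OF pd_W[OF R(2) ab(1)] pd_W[OF Q(2) ab(2)]] u]]
      by (simp add: mult.commute)
    show "set_integrable lborel \<Omega> (\<lambda>z. \<bar>u z\<bar> * (pd a (R \<epsilon>) z)\<^sup>2 + \<bar>u z\<bar> * (pd b (Q \<epsilon>) z)\<^sup>2)"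
      by (intro set_integral_add r q)
    fix z
    let ?x = "pd a (R \<epsilon>) z" and ?y = "pd b (Q \<epsilon>) z"
    have "2 * (\<bar>?x\<bar> * \<bar>?y\<bar>) \<le> ?x\<^sup>2 + ?y\<^sup>2"
      using sum_squares_bound[of "\<bar>?x\<bar>" "\<bar>?y\<bar>"] by (simp add: mult.assoc)
    moreover have "0 \<le> \<bar>?x\<bar> * \<bar>?y\<bar>" by simp
    ultimately have "\<bar>?x\<bar> * \<bar>?y\<bar> \<le> ?x\<^sup>2 + ?y\<^sup>2" by linarith
    from mult_left_mono[OF this, of "\<bar>u z\<bar>"]
    show "\<bar>u z * (?x * ?y)\<bar> \<le> \<bar>u z\<bar> * ?x\<^sup>2 + \<bar>u z\<bar> * ?y\<^sup>2"
      by (simp add: abs_mult algebra_simps)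
  qed
  then show "\<forall>\<^sub>F \<epsilon> in at 0. norm (LINT z:\<Omega>|lborel. u z * (pd a (R \<epsilon>) z * pd b (Q \<epsilon>) z))
      \<le> (LINT z:\<Omega>|lborel. \<bar>u z\<bar> * (pd a (R \<epsilon>) z)\<^sup>2) + (LINT z:\<Omega>|lborel. \<bar>u z\<bar> * (pd b (Q \<epsilon>) z)\<^sup>2)"
    using r(2) q(2) by simp
qed

text \<open>The coefficients \<open>\<pi> a b * u\<close> belong to \<open>V\<close>, hence are admissible weights even though \<open>B\<close> may
  be unbounded.\<close>

lemma LINT_bracket_expand:
  assumes u: "u \<in> V" and m: "m \<in> W" and n: "n \<in> W"
  shows "(LINT z:\<Omega>|lborel. u z * pb m n z)
    = (\<Sum>a\<in>Basis. \<Sum>b\<in>Basis. LINT z:\<Omega>|lborel. \<pi> a b z * u z * (pd a m z * pd b n z))"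
proof -
  have int: "set_integrable lborel \<Omega> (\<lambda>z. \<pi> a b z * u z * (pd a m z * pd b n z))"
    if "a \<in> Basis" "b \<in> Basis" for a b
    using V_integrable[OF V_mult[OF W_mult[OF pd_W[OF m that(1)] pd_W[OF n that(2)]]
        module_tensor[OF B_class W_module_V u, of a b]]]
    by (simp add: mult.commute)
  have "(LINT z:\<Omega>|lborel. u z * pb m n z)
      = (LINT z:\<Omega>|lborel. (\<Sum>a\<in>Basis. \<Sum>b\<in>Basis. \<pi> a b z * u z * (pd a m z * pd b n z)))"
    by (simp add: poisson_bracket_def sum_distrib_left mult_ac)
  then show ?thesis using int by (simp add: LINT_sum set_integrable_sum)
qed

lemma bracket_null_left:
  assumes R: "weighted_H1_null \<Omega> U R" "\<And>\<epsilon>. R \<epsilon> \<in> W" and u: "u \<in> V" and n: "n \<in> W"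
  shows "((\<lambda>\<epsilon>. LINT z:\<Omega>|lborel. u z * pb (R \<epsilon>) n z) \<longlongrightarrow> 0) (at 0)"
  unfolding LINT_bracket_expand[OF u R(2) n]
proof (intro tendsto_null_sum)
  fix a b :: phase assume ab: "a \<in> Basis" "b \<in> Basis"
  have "(\<lambda>z. pd b n z * (\<pi> a b z * u z)) \<in> U"
    using V_mult[OF pd_W[OF n ab(2)] module_tensor[OF B_class W_module_V u, of a b]] V_subset_U by auto
  from null_linear[OF R this ab(1)]
  show "((\<lambda>\<epsilon>. LINT z:\<Omega>|lborel. \<pi> a b z * u z * (pd a (R \<epsilon>) z * pd b n z)) \<longlongrightarrow> 0) (at 0)"
    by (simp add: mult_ac)
qed

lemma bracket_null_both:
  assumes R: "weighted_H1_null \<Omega> U R" "\<And>\<epsilon>. R \<epsilon> \<in> W"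
    and Q: "weighted_H1_null \<Omega> U Q" "\<And>\<epsilon>. Q \<epsilon> \<in> W" and u: "u \<in> V"
  shows "((\<lambda>\<epsilon>. LINT z:\<Omega>|lborel. u z * pb (R \<epsilon>) (Q \<epsilon>) z) \<longlongrightarrow> 0) (at 0)"
  unfolding LINT_bracket_expand[OF u R(2) Q(2)]
proof (intro tendsto_null_sum null_bilinear R Q)
  fix a b :: phase
  show "(\<lambda>z. \<pi> a b z * u z) \<in> U"
    using module_tensor[OF B_class W_module_V u, of a b] V_subset_U by auto
qed

lemma second_variation_W: "has_second_variation \<Omega> V U W F f S \<Longrightarrow> u \<in> U \<Longrightarrow> S u \<in> W"
  by (simp add: has_second_variation_def)

lemma second_variation_sym:
  "has_second_variation \<Omega> V U W F f S \<Longrightarrow> u \<in> U \<Longrightarrow> v \<in> U \<Longrightarrow>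
    (LINT z:\<Omega>|lborel. S u z * v z) = (LINT z:\<Omega>|lborel. u z * S v z)"
  by (simp add: has_second_variation_def)

lemma LINT_minus: "(LINT z:\<Omega>|lborel. - k z) = - (LINT z:\<Omega>|lborel. (k z :: real))"
  by (simp add: set_lebesgue_integral_def)

text \<open>Writing the perturbed variational derivative with a remainder \<open>R\<close> inside the factor \<open>\<epsilon>\<close> makes the
  difference quotient of the bracket a polynomial in brackets of \<open>S \<psi> + R \<epsilon>\<close> with fixed functions.\<close>

lemma vd_difference_quotient:
  assumes F: "variationally_differentiable \<Omega> V W F"
    and S: "has_second_variation \<Omega> V U W F f S" and f: "f \<in> V" and \<psi>: "\<psi> \<in> V"
  obtains R where "weighted_H1_null \<Omega> U R" "\<And>\<epsilon>. R \<epsilon> \<in> W"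
    "\<And>\<epsilon> z. vd F (\<lambda>y. f y + \<epsilon> * \<psi> y) z = vd F f z + \<epsilon> * (S \<psi> z + R \<epsilon> z)"
proof
  let ?R = "\<lambda>\<epsilon> z. (vd F (\<lambda>y. f y + \<epsilon> * \<psi> y) z - vd F f z) / \<epsilon> - S \<psi> z"
  show "weighted_H1_null \<Omega> U ?R"
    using S \<psi> by (simp add: has_second_variation_def)
  have "S \<psi> \<in> W" using second_variation_W[OF S] \<psi> V_subset_U by blast
  then have "(\<lambda>z. (1 / \<epsilon>) * vd F (\<lambda>y. f y + \<epsilon> * \<psi> y) z + ((- 1 / \<epsilon>) * vd F f z + (- 1) * S \<psi> z)) \<in> W" for \<epsilon>
    by (intro W_add W_scale vd_W F V_add V_scale f \<psi>)
  then show "?R \<epsilon> \<in> W" for \<epsilon>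
    by (rule W_cong) (simp add: diff_divide_distrib)
  show "vd F (\<lambda>y. f y + \<epsilon> * \<psi> y) z = vd F f z + \<epsilon> * (S \<psi> z + ?R \<epsilon> z)" for \<epsilon> z
    \<comment> \<open>division by zero yields zero, so for \<open>\<epsilon> = 0\<close> the remainder is \<open>- S \<psi>\<close>, with coefficient zero\<close>
    by (cases "\<epsilon> = 0") simp_all
qed

text \<open>The Horner form in \<open>\<epsilon>\<close> lets the difference quotient be read off.\<close>

lemma LINT_bracket_expand_perturbation:
  assumes f: "f \<in> V" and \<psi>: "\<psi> \<in> V" and W: "m \<in> W" "n \<in> W" "p \<in> W" "q \<in> W"
  shows "(LINT z:\<Omega>|lborel. (f z + \<epsilon> * \<psi> z) * pb (\<lambda>z. m z + \<epsilon> * p z) (\<lambda>z. n z + \<epsilon> * q z) z)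
    = (LINT z:\<Omega>|lborel. f z * pb m n z)
    + \<epsilon> * ((LINT z:\<Omega>|lborel. \<psi> z * pb m n z) + (LINT z:\<Omega>|lborel. f z * pb p n z) + (LINT z:\<Omega>|lborel. f z * pb m q z)
      + \<epsilon> * ((LINT z:\<Omega>|lborel. f z * pb p q z) + (LINT z:\<Omega>|lborel. \<psi> z * pb p n z) + (LINT z:\<Omega>|lborel. \<psi> z * pb m q z)
        + \<epsilon> * (LINT z:\<Omega>|lborel. \<psi> z * pb p q z)))"
proof -
  have int: "set_integrable lborel \<Omega> (\<lambda>z. u z * pb w w' z)" if "u \<in> V" "w \<in> W" "w' \<in> W" for u w w'
    by (intro V_integrable pb_V that)
  note ints = int[OF f W(1,2)] int[OF f W(3,2)] int[OF f W(1,4)] int[OF f W(3,4)]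
    int[OF \<psi> W(1,2)] int[OF \<psi> W(3,2)] int[OF \<psi> W(1,4)] int[OF \<psi> W(3,4)]
  have "(LINT z:\<Omega>|lborel. (f z + \<epsilon> * \<psi> z) * pb (\<lambda>z. m z + \<epsilon> * p z) (\<lambda>z. n z + \<epsilon> * q z) z)
    = (LINT z:\<Omega>|lborel. f z * pb m n z
    + \<epsilon> * (\<psi> z * pb m n z + f z * pb p n z + f z * pb m q z
      + \<epsilon> * (f z * pb p q z + \<psi> z * pb p n z + \<psi> z * pb m q z
        + \<epsilon> * (\<psi> z * pb p q z))))"
  proof (rule LINT_cong)
    fix z assume z: "z \<in> \<Omega>"
    have d: "w differentiable (at z)" if "w \<in> W" for w by (rule W_differentiable[OF that z])
    have "pb (\<lambda>z. m z + \<epsilon> * p z) (\<lambda>z. n z + \<epsilon> * q z) z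
        = pb m n z + \<epsilon> * pb p n z + \<epsilon> * (pb m q z + \<epsilon> * pb p q z)"
      by (simp add: pb_add_left pb_add_right pb_scale_left pb_scale_right W_add W_scale d W distrib_left)
    then show "(f z + \<epsilon> * \<psi> z) * pb (\<lambda>z. m z + \<epsilon> * p z) (\<lambda>z. n z + \<epsilon> * q z) z = f z * pb m n z
    + \<epsilon> * (\<psi> z * pb m n z + f z * pb p n z + f z * pb m q z
      + \<epsilon> * (f z * pb p q z + \<psi> z * pb p n z + \<psi> z * pb m q z
        + \<epsilon> * (\<psi> z * pb p q z)))"
      by (simp add: algebra_simps)
  qed
  then show ?thesis using ints by simp
qed

lemma bracket_null_right:
  assumes R: "weighted_H1_null \<Omega> U R" "\<And>\<epsilon>. R \<epsilon> \<in> W" and u: "u \<in> V" and m: "m \<in> W"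
  shows "((\<lambda>\<epsilon>. LINT z:\<Omega>|lborel. u z * pb m (R \<epsilon>) z) \<longlongrightarrow> 0) (at 0)"
proof -
  have "(LINT z:\<Omega>|lborel. u z * pb m (R \<epsilon>) z) = - (LINT z:\<Omega>|lborel. u z * pb (R \<epsilon>) m z)" for \<epsilon>
    by (simp add: poisson_bracket_antisym[of B m] LINT_minus)
  then show ?thesis using tendsto_minus[OF bracket_null_left[OF assms]] by simp
qed

lemma LINT_pb_add_left:
  assumes "u \<in> V" "p \<in> W" "p' \<in> W" "n \<in> W"
  shows "(LINT z:\<Omega>|lborel. u z * pb (\<lambda>z. p z + p' z) n z)
    = (LINT z:\<Omega>|lborel. u z * pb p n z) + (LINT z:\<Omega>|lborel. u z * pb p' n z)"
proof -
  have "(LINT z:\<Omega>|lborel. u z * pb (\<lambda>z. p z + p' z) n z)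
    = (LINT z:\<Omega>|lborel. u z * pb p n z + u z * pb p' n z)"
    by (rule LINT_cong) (simp add: pb_add_left W_differentiable assms distrib_left)
  then show ?thesis by (simp add: V_integrable pb_V assms)
qed

lemma LINT_pb_add_right:
  assumes "u \<in> V" "p \<in> W" "p' \<in> W" "n \<in> W"
  shows "(LINT z:\<Omega>|lborel. u z * pb n (\<lambda>z. p z + p' z) z)
    = (LINT z:\<Omega>|lborel. u z * pb n p z) + (LINT z:\<Omega>|lborel. u z * pb n p' z)"
proof -
  have "(LINT z:\<Omega>|lborel. u z * pb n (\<lambda>z. p z + p' z) z)
    = (LINT z:\<Omega>|lborel. u z * pb n p z + u z * pb n p' z)"
    by (rule LINT_cong) (simp add: pb_add_right W_differentiable assms distrib_left)
  then show ?thesis by (simp add: V_integrable pb_V assms)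
qed

text \<open>The product rule for \<open>\<integral> f [\<delta>F/\<delta>f, \<delta>G/\<delta>f]\<close>. Everything beyond the three terms in the limit
  carries a factor \<open>\<epsilon>\<close> or contains a remainder that is null in weighted \<open>H\<^sup>1\<close>; the brackets
  involve only first derivatives, so that convergence in \<open>H\<^sup>1\<close> suffices.\<close>

lemma bracket_first_variation:
  assumes F: "variationally_differentiable \<Omega> V W F" and G: "variationally_differentiable \<Omega> V W G"
    and S: "has_second_variation \<Omega> V U W F f S" and T: "has_second_variation \<Omega> V U W G f T"
    and f: "f \<in> V" and \<psi>: "\<psi> \<in> V"
  shows "((\<lambda>\<epsilon>. (magnetic_bracket \<Omega> V B F G (\<lambda>z. f z + \<epsilon> * \<psi> z) - magnetic_bracket \<Omega> V B F G f) / \<epsilon>)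
    \<longlongrightarrow> (LINT z:\<Omega>|lborel. \<psi> z * pb (vd F f) (vd G f) z)
      + (LINT z:\<Omega>|lborel. f z * pb (S \<psi>) (vd G f) z)
      + (LINT z:\<Omega>|lborel. f z * pb (vd F f) (T \<psi>) z)) (at 0)"
proof -
  let ?m = "vd F f" and ?n = "vd G f"
  have ST: "S \<psi> \<in> W" "T \<psi> \<in> W"
    using second_variation_W[OF S] second_variation_W[OF T] \<psi> V_subset_U by blast+
  note mn = vd_W[OF F f] vd_W[OF G f]
  obtain R where R: "weighted_H1_null \<Omega> U R" "\<And>\<epsilon>. R \<epsilon> \<in> W"
    "\<And>\<epsilon> z. vd F (\<lambda>y. f y + \<epsilon> * \<psi> y) z = ?m z + \<epsilon> * (S \<psi> z + R \<epsilon> z)"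
    by (rule vd_difference_quotient[OF F S f \<psi>]) blast
  obtain Q where Q: "weighted_H1_null \<Omega> U Q" "\<And>\<epsilon>. Q \<epsilon> \<in> W"
    "\<And>\<epsilon> z. vd G (\<lambda>y. f y + \<epsilon> * \<psi> y) z = ?n z + \<epsilon> * (T \<psi> z + Q \<epsilon> z)"
    by (rule vd_difference_quotient[OF G T f \<psi>]) blast
  define A where "A \<epsilon> z = S \<psi> z + R \<epsilon> z" for \<epsilon> z
  define C where "C \<epsilon> z = T \<psi> z + Q \<epsilon> z" for \<epsilon> z
  have AC: "A \<epsilon> \<in> W" "C \<epsilon> \<in> W" for \<epsilon>
    unfolding A_def[abs_def] C_def[abs_def] by (intro W_add ST R Q)+
  define P where "P u a b = (LINT z:\<Omega>|lborel. u z * pb a b z)" for u a b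
  have limA: "((\<lambda>\<epsilon>. P u (A \<epsilon>) ?n) \<longlongrightarrow> P u (S \<psi>) ?n) (at 0)" if u: "u \<in> V" for u
    unfolding P_def A_def[abs_def] LINT_pb_add_left[OF u ST(1) R(2) mn(2)]
    using tendsto_add[OF tendsto_const bracket_null_left[OF R(1,2) u mn(2)]] by simp
  have limC: "((\<lambda>\<epsilon>. P u ?m (C \<epsilon>)) \<longlongrightarrow> P u ?m (T \<psi>)) (at 0)" if u: "u \<in> V" for u
    unfolding P_def C_def[abs_def] LINT_pb_add_right[OF u ST(2) Q(2) mn(1)]
    using tendsto_add[OF tendsto_const bracket_null_right[OF Q(1,2) u mn(1)]] by simp
  have limAC: "((\<lambda>\<epsilon>. P u (A \<epsilon>) (C \<epsilon>)) \<longlongrightarrow> P u (S \<psi>) (T \<psi>)) (at 0)" if u: "u \<in> V" for u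
  proof -
    have e: "P u (A \<epsilon>) (C \<epsilon>) = (P u (S \<psi>) (T \<psi>) + P u (S \<psi>) (Q \<epsilon>)) + (P u (R \<epsilon>) (T \<psi>) + P u (R \<epsilon>) (Q \<epsilon>))" for \<epsilon>
      unfolding P_def A_def[abs_def]
      using LINT_pb_add_left[OF u ST(1) R(2) AC(2)] LINT_pb_add_right[OF u ST(2) Q(2) ST(1)]
        LINT_pb_add_right[OF u ST(2) Q(2) R(2)]
      by (simp add: C_def[abs_def])
    have "((\<lambda>\<epsilon>. (P u (S \<psi>) (T \<psi>) + P u (S \<psi>) (Q \<epsilon>)) + (P u (R \<epsilon>) (T \<psi>) + P u (R \<epsilon>) (Q \<epsilon>)))
        \<longlongrightarrow> (P u (S \<psi>) (T \<psi>) + 0) + (0 + 0)) (at 0)"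
      unfolding P_def
      by (intro tendsto_add tendsto_const bracket_null_right[OF Q(1,2) u ST(1)]
          bracket_null_left[OF R(1,2) u ST(2)] bracket_null_both[OF R(1,2) Q(1,2) u])
    then show ?thesis by (simp add: e)
  qed
  have fV: "(\<lambda>z. f z + \<epsilon> * \<psi> z) \<in> V" for \<epsilon> by (intro V_add V_scale f \<psi>)
  have quot: "(magnetic_bracket \<Omega> V B F G (\<lambda>z. f z + \<epsilon> * \<psi> z) - magnetic_bracket \<Omega> V B F G f) / \<epsilon>
      = P \<psi> ?m ?n + P f (A \<epsilon>) ?n + P f ?m (C \<epsilon>)
        + \<epsilon> * (P f (A \<epsilon>) (C \<epsilon>) + P \<psi> (A \<epsilon>) ?n + P \<psi> ?m (C \<epsilon>) + \<epsilon> * P \<psi> (A \<epsilon>) (C \<epsilon>))"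
    if "\<epsilon> \<noteq> 0" for \<epsilon>
  proof -
    have vds: "vd F (\<lambda>y. f y + \<epsilon> * \<psi> y) = (\<lambda>z. ?m z + \<epsilon> * A \<epsilon> z)"
      "vd G (\<lambda>y. f y + \<epsilon> * \<psi> y) = (\<lambda>z. ?n z + \<epsilon> * C \<epsilon> z)"
      by (simp_all add: fun_eq_iff R(3) Q(3) A_def C_def)
    have "magnetic_bracket \<Omega> V B F G (\<lambda>z. f z + \<epsilon> * \<psi> z)
        = (LINT z:\<Omega>|lborel. (f z + \<epsilon> * \<psi> z) * pb (\<lambda>z. ?m z + \<epsilon> * A \<epsilon> z) (\<lambda>z. ?n z + \<epsilon> * C \<epsilon> z) z)"
      using magnetic_bracket_eq[OF fV vd_W[OF F fV] vd_W[OF G fV]] by (simp add: vds)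
    moreover have "magnetic_bracket \<Omega> V B F G f = P f ?m ?n"
      unfolding P_def by (rule magnetic_bracket_eq[OF f mn])
    ultimately show ?thesis
      using that by (simp add: LINT_bracket_expand_perturbation[OF f \<psi> mn AC] P_def[symmetric])
  qed
  have "((\<lambda>\<epsilon>. P \<psi> ?m ?n + P f (A \<epsilon>) ?n + P f ?m (C \<epsilon>)
        + \<epsilon> * (P f (A \<epsilon>) (C \<epsilon>) + P \<psi> (A \<epsilon>) ?n + P \<psi> ?m (C \<epsilon>) + \<epsilon> * P \<psi> (A \<epsilon>) (C \<epsilon>)))
     \<longlongrightarrow> P \<psi> ?m ?n + P f (S \<psi>) ?n + P f ?m (T \<psi>)
        + 0 * (P f (S \<psi>) (T \<psi>) + P \<psi> (S \<psi>) ?n + P \<psi> ?m (T \<psi>) + 0 * P \<psi> (S \<psi>) (T \<psi>))) (at 0)"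
    by (intro tendsto_intros limA limC limAC f \<psi>)
  then have "((\<lambda>\<epsilon>. P \<psi> ?m ?n + P f (A \<epsilon>) ?n + P f ?m (C \<epsilon>)
        + \<epsilon> * (P f (A \<epsilon>) (C \<epsilon>) + P \<psi> (A \<epsilon>) ?n + P \<psi> ?m (C \<epsilon>) + \<epsilon> * P \<psi> (A \<epsilon>) (C \<epsilon>)))
     \<longlongrightarrow> P \<psi> ?m ?n + P f (S \<psi>) ?n + P f ?m (T \<psi>)) (at 0)" by simp
  then show ?thesis
    unfolding P_def[symmetric]
    by (rule Lim_transform_eventually) (auto simp: eventually_at_filter quot)
qed

text \<open>Integration by parts moves the derivatives off \<open>S \<psi>\<close>, after which self-adjointness moves \<open>S\<close> off
  \<open>\<psi>\<close>.\<close>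

lemma LINT_second_variation:
  assumes S: "has_second_variation \<Omega> V U W F f S" and f: "f \<in> V" and \<psi>: "\<psi> \<in> V" and n: "n \<in> W"
  shows "(LINT z:\<Omega>|lborel. f z * pb (S \<psi>) n z) = (LINT z:\<Omega>|lborel. S (pb n f) z * \<psi> z)"
proof -
  have U: "\<psi> \<in> U" "pb n f \<in> U" using \<psi> V_subset_U pb_U[OF n f] by auto
  then have "S \<psi> \<in> W" using second_variation_W[OF S] by blast
  then have "(LINT z:\<Omega>|lborel. f z * pb (S \<psi>) n z) = (LINT z:\<Omega>|lborel. S \<psi> z * pb n f z)"
    by (intro bracket_by_parts f n)
  also have "\<dots> = (LINT z:\<Omega>|lborel. \<psi> z * S (pb n f) z)"
    by (rule second_variation_sym[OF S U])
  finally show ?thesis by (simp add: mult.commute)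
qed

text \<open>The first variation, rewritten as an integral against \<open>\<psi>\<close>, determines the variational derivative
  by uniqueness.\<close>

lemma vd_magnetic_bracket:
  assumes F: "variationally_differentiable \<Omega> V W F" and G: "variationally_differentiable \<Omega> V W G"
    and S: "has_second_variation \<Omega> V U W F f S" and T: "has_second_variation \<Omega> V U W G f T"
    and f: "f \<in> V" and z: "z \<in> \<Omega>"
  shows "vd (magnetic_bracket \<Omega> V B F G) f z
    = pb (vd F f) (vd G f) z + S (pb (vd G f) f) z + T (pb f (vd F f)) z"
proof -
  let ?m = "vd F f" and ?n = "vd G f"
  note mn = vd_W[OF F f] vd_W[OF G f]
  have ST: "S (pb ?n f) \<in> W" "T (pb f ?m) \<in> W"
    using second_variation_W[OF S pb_U[OF mn(2) f]] second_variation_W[OF T pb_U'[OF mn(1) f]] .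
  show ?thesis
  proof (rule vd_eqI[OF _ _ z])
    show "(\<lambda>z. pb ?m ?n z + S (pb ?n f) z + T (pb f ?m) z) \<in> W"
      by (intro W_add pb_W mn ST)
    fix \<psi> assume \<psi>: "\<psi> \<in> V"
    have U: "\<psi> \<in> U" "pb f ?m \<in> U" using \<psi> V_subset_U pb_U'[OF mn(1) f] by auto
    have T\<psi>: "T \<psi> \<in> W" by (rule second_variation_W[OF T U(1)])
    have "(LINT z:\<Omega>|lborel. f z * pb ?m (T \<psi>) z) = - (LINT z:\<Omega>|lborel. f z * pb (T \<psi>) ?m z)"
      by (simp add: poisson_bracket_antisym[of B ?m] LINT_minus)
    also have "\<dots> = (LINT z:\<Omega>|lborel. T \<psi> z * pb f ?m z)"
      by (simp add: bracket_by_parts[OF f T\<psi> mn(1)] poisson_bracket_antisym[of B f] LINT_minus)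
    also have "\<dots> = (LINT z:\<Omega>|lborel. \<psi> z * T (pb f ?m) z)"
      by (rule second_variation_sym[OF T U])
    finally have 2: "(LINT z:\<Omega>|lborel. f z * pb ?m (T \<psi>) z) = (LINT z:\<Omega>|lborel. T (pb f ?m) z * \<psi> z)"
      by (simp add: mult.commute)
    have int: "set_integrable lborel \<Omega> (\<lambda>z. w z * \<psi> z)" if "w \<in> W" for w
      by (intro V_integrable V_mult that \<psi>)
    have "(LINT z:\<Omega>|lborel. (pb ?m ?n z + S (pb ?n f) z + T (pb f ?m) z) * \<psi> z)
        = (LINT z:\<Omega>|lborel. pb ?m ?n z * \<psi> z) + (LINT z:\<Omega>|lborel. S (pb ?n f) z * \<psi> z)
          + (LINT z:\<Omega>|lborel. T (pb f ?m) z * \<psi> z)"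
      by (simp add: distrib_right int ST pb_W mn)
    also have "\<dots> = (LINT z:\<Omega>|lborel. \<psi> z * pb ?m ?n z) + (LINT z:\<Omega>|lborel. f z * pb (S \<psi>) ?n z)
          + (LINT z:\<Omega>|lborel. f z * pb ?m (T \<psi>) z)"
      by (simp add: 2 LINT_second_variation[OF S f \<psi> mn(2)] mult.commute)
    finally show "((\<lambda>\<epsilon>. (magnetic_bracket \<Omega> V B F G (\<lambda>z. f z + \<epsilon> * \<psi> z) - magnetic_bracket \<Omega> V B F G f) / \<epsilon>)
      \<longlongrightarrow> (LINT z:\<Omega>|lborel. (pb ?m ?n z + S (pb ?n f) z + T (pb f ?m) z) * \<psi> z)) (at 0)"
      using bracket_first_variation[OF F G S T f \<psi>] by simp
  qed
qed

section \<open>The bracket is a Lie bracket\<close>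

lemma magnetic_bracket_antisym:
  "magnetic_bracket \<Omega> V B F G f = - magnetic_bracket \<Omega> V B G F f"
proof -
  have can: "(LINT z:\<Omega>|lborel. f z * canonical_bracket m n z)
      = - (LINT z:\<Omega>|lborel. f z * canonical_bracket n m z)" for m n
    by (subst LINT_minus[symmetric], rule LINT_cong)
      (simp add: canonical_bracket_def inner_commute algebra_simps)
  have mag: "(LINT z:\<Omega>|lborel. f z * (B (fst z) \<bullet> cross3 (u z) (v z)))
      = - (LINT z:\<Omega>|lborel. f z * (B (fst z) \<bullet> cross3 (v z) (u z)))" for u v
    by (subst LINT_minus[symmetric], rule LINT_cong) (subst cross_skew, simp)
  show ?thesis
    unfolding magnetic_bracket_def
    using can[of "vd F f" "vd G f"] mag[of "grad_v (vd F f)" "grad_v (vd G f)"] by linarith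
qed

lemma magnetic_bracket_linear_left:
  assumes F: "variationally_differentiable \<Omega> V W F" and G: "variationally_differentiable \<Omega> V W G"
    and H: "variationally_differentiable \<Omega> V W H" and f: "f \<in> V"
  shows "magnetic_bracket \<Omega> V B (\<lambda>h. a * F h + b * G h) H f
    = a * magnetic_bracket \<Omega> V B F H f + b * magnetic_bracket \<Omega> V B G H f"
proof -
  let ?m = "vd F f" and ?n = "vd G f" and ?h = "vd H f"
  let ?l = "\<lambda>z. a * ?m z + b * ?n z"
  note W = vd_W[OF F f] vd_W[OF G f] vd_W[OF H f]
  have lW: "?l \<in> W" by (intro W_add W_scale W)
  have vl: "vd (\<lambda>h. a * F h + b * G h) f z = ?l z" if "z \<in> \<Omega>" for z
    by (rule vd_linear[OF F G f that])
  have vlW: "vd (\<lambda>h. a * F h + b * G h) f \<in> W"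
    by (rule W_cong[OF lW vl])
  have "magnetic_bracket \<Omega> V B (\<lambda>h. a * F h + b * G h) H f
      = (LINT z:\<Omega>|lborel. a * (f z * pb ?m ?h z) + b * (f z * pb ?n ?h z))"
    unfolding magnetic_bracket_eq[OF f vlW W(3)]
  proof (rule LINT_cong)
    fix z assume z: "z \<in> \<Omega>"
    have d: "w differentiable (at z)" if "w \<in> W" for w by (rule W_differentiable[OF that z])
    have "pb (vd (\<lambda>h. a * F h + b * G h) f) ?h z = pb ?l ?h z"
      using vl z by (intro pb_cong) auto
    also have "\<dots> = a * pb ?m ?h z + b * pb ?n ?h z"
      by (simp add: pb_add_left pb_scale_left W_scale d W)
    finally show "f z * pb (vd (\<lambda>h. a * F h + b * G h) f) ?h z
        = a * (f z * pb ?m ?h z) + b * (f z * pb ?n ?h z)"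
      by (simp add: algebra_simps)
  qed
  also have "\<dots> = a * magnetic_bracket \<Omega> V B F H f + b * magnetic_bracket \<Omega> V B G H f"
    using V_integrable[OF pb_V[OF f W(1,3)]] V_integrable[OF pb_V[OF f W(2,3)]]
    by (simp add: magnetic_bracket_eq[OF f] W)
  finally show ?thesis .
qed

lemma magnetic_bracket_linear_right:
  assumes F: "variationally_differentiable \<Omega> V W F" and G: "variationally_differentiable \<Omega> V W G"
    and H: "variationally_differentiable \<Omega> V W H" and f: "f \<in> V"
  shows "magnetic_bracket \<Omega> V B H (\<lambda>h. a * F h + b * G h) f
    = a * magnetic_bracket \<Omega> V B H F f + b * magnetic_bracket \<Omega> V B H G f"
  using magnetic_bracket_linear_left[OF assms] by (simp add: magnetic_bracket_antisym[of H])

lemma magnetic_bracket_nested: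
  assumes F: "variationally_differentiable \<Omega> V W F" and G: "variationally_differentiable \<Omega> V W G"
    and H: "variationally_differentiable \<Omega> V W H"
    and FG: "variationally_differentiable \<Omega> V W (magnetic_bracket \<Omega> V B F G)"
    and S: "has_second_variation \<Omega> V U W F f S" and T: "has_second_variation \<Omega> V U W G f T"
    and f: "f \<in> V"
  shows "magnetic_bracket \<Omega> V B (magnetic_bracket \<Omega> V B F G) H f
    = (LINT z:\<Omega>|lborel. f z * pb (pb (vd F f) (vd G f)) (vd H f) z)
    + (LINT z:\<Omega>|lborel. S (pb (vd G f) f) z * pb (vd H f) f z)
    + (LINT z:\<Omega>|lborel. T (pb f (vd F f)) z * pb (vd H f) f z)"
proof -
  let ?m = "vd F f" and ?n = "vd G f" and ?h = "vd H f" and ?k = "vd (magnetic_bracket \<Omega> V B F G) f"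
  note W = vd_W[OF F f] vd_W[OF G f] vd_W[OF H f]
  have ST: "S (pb ?n f) \<in> W" "T (pb f ?m) \<in> W"
    using second_variation_W[OF S pb_U[OF W(2) f]] second_variation_W[OF T pb_U'[OF W(1) f]] .
  have "magnetic_bracket \<Omega> V B (magnetic_bracket \<Omega> V B F G) H f = (LINT z:\<Omega>|lborel. f z * pb ?k ?h z)"
    by (rule magnetic_bracket_eq[OF f vd_W[OF FG f] W(3)])
  also have "\<dots> = (LINT z:\<Omega>|lborel. f z * pb (\<lambda>z. (pb ?m ?n z + S (pb ?n f) z) + T (pb f ?m) z) ?h z)"
    by (intro LINT_cong arg_cong2[where f = times] refl pb_cong)
      (simp_all add: vd_magnetic_bracket[OF F G S T f])
  also have "\<dots> = (LINT z:\<Omega>|lborel. f z * pb (pb ?m ?n) ?h z)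
      + (LINT z:\<Omega>|lborel. f z * pb (S (pb ?n f)) ?h z) + (LINT z:\<Omega>|lborel. f z * pb (T (pb f ?m)) ?h z)"
    by (simp add: LINT_pb_add_left[OF f] W_add pb_W ST W)
  finally show ?thesis
    by (simp add: bracket_by_parts[OF f ST(1) W(3)] bracket_by_parts[OF f ST(2) W(3)])
qed

text \<open>Self-adjointness alone gives the cancellation: it moves \<open>S\<close> from \<open>[f, h]\<close> to
  \<open>[n, f]\<close>, and then \<open>[f, h] = - [h, f]\<close> stands outside \<open>S\<close>.\<close>

lemma second_variation_swap:
  assumes S: "has_second_variation \<Omega> V U W F f S" and f: "f \<in> V" and n: "n \<in> W" and h: "h \<in> W"
  shows "(LINT z:\<Omega>|lborel. S (pb n f) z * pb h f z) + (LINT z:\<Omega>|lborel. S (pb f h) z * pb n f z) = 0"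
proof -
  have U: "pb n f \<in> U" "pb f h \<in> U" using pb_U pb_U' f n h by auto
  have "(LINT z:\<Omega>|lborel. S (pb f h) z * pb n f z) = (LINT z:\<Omega>|lborel. pb f h z * S (pb n f) z)"
    by (rule second_variation_sym[OF S U(2,1)])
  also have "\<dots> = (LINT z:\<Omega>|lborel. - (S (pb n f) z * pb h f z))"
    by (simp add: poisson_bracket_antisym[of B f] mult.commute)
  finally show ?thesis by (simp add: LINT_minus)
qed

lemma magnetic_bracket_jacobi:
  assumes div: "\<And>x. x \<in> \<Omega>x \<Longrightarrow> divergence B x = 0"
    and F: "is_functional \<Omega> V U W F" and G: "is_functional \<Omega> V U W G" and H: "is_functional \<Omega> V U W H"
    and FG: "variationally_differentiable \<Omega> V W (magnetic_bracket \<Omega> V B F G)"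
    and GH: "variationally_differentiable \<Omega> V W (magnetic_bracket \<Omega> V B G H)"
    and HF: "variationally_differentiable \<Omega> V W (magnetic_bracket \<Omega> V B H F)"
    and f: "f \<in> V"
  shows "magnetic_bracket \<Omega> V B (magnetic_bracket \<Omega> V B F G) H f
    + magnetic_bracket \<Omega> V B (magnetic_bracket \<Omega> V B G H) F f
    + magnetic_bracket \<Omega> V B (magnetic_bracket \<Omega> V B H F) G f = 0"
proof -
  note vF = conjunct1[OF F[unfolded is_functional_def]]
    and vG = conjunct1[OF G[unfolded is_functional_def]]
    and vH = conjunct1[OF H[unfolded is_functional_def]]
  obtain S T R where S: "has_second_variation \<Omega> V U W F f S"
    and T: "has_second_variation \<Omega> V U W G f T" and R: "has_second_variation \<Omega> V U W H f R"
    using F G H f unfolding is_functional_def by blast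
  let ?m = "vd F f" and ?n = "vd G f" and ?h = "vd H f"
  note W = vd_W[OF vF f] vd_W[OF vG f] vd_W[OF vH f]
  have int: "set_integrable lborel \<Omega> (\<lambda>z. f z * pb (pb p q) r z)" if "p \<in> W" "q \<in> W" "r \<in> W" for p q r
    by (intro V_integrable pb_V pb_W f that)
  have "(LINT z:\<Omega>|lborel. f z * pb (pb ?m ?n) ?h z) + (LINT z:\<Omega>|lborel. f z * pb (pb ?n ?h) ?m z)
      + (LINT z:\<Omega>|lborel. f z * pb (pb ?h ?m) ?n z)
    = (LINT z:\<Omega>|lborel. f z * pb (pb ?m ?n) ?h z + f z * pb (pb ?n ?h) ?m z + f z * pb (pb ?h ?m) ?n z)"
    by (simp add: int W)
  also have "\<dots> = (LINT z:\<Omega>|lborel. 0)"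
  proof (rule LINT_cong)
    fix z assume "z \<in> \<Omega>"
    then have "pb (pb ?m ?n) ?h z + pb (pb ?n ?h) ?m z + pb (pb ?h ?m) ?n z = 0"
      using div by (intro pb_jacobi W) auto
    then show "f z * pb (pb ?m ?n) ?h z + f z * pb (pb ?n ?h) ?m z + f z * pb (pb ?h ?m) ?n z = 0"
      by (simp add: distrib_left[symmetric])
  qed
  finally have "(LINT z:\<Omega>|lborel. f z * pb (pb ?m ?n) ?h z) + (LINT z:\<Omega>|lborel. f z * pb (pb ?n ?h) ?m z)
      + (LINT z:\<Omega>|lborel. f z * pb (pb ?h ?m) ?n z) = 0" by simp
  then show ?thesis
    unfolding magnetic_bracket_nested[OF vF vG vH FG S T f] magnetic_bracket_nested[OF vG vH vF GH T R f]
      magnetic_bracket_nested[OF vH vF vG HF R S f]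
    using second_variation_swap[OF S f W(2,3)] second_variation_swap[OF T f W(3,1)]
      second_variation_swap[OF R f W(1,2)]
    by linarith
qed

end

theorem mainTheorem1:
  fixes \<Omega>x \<Omega>v :: "(real^3) set" and V U W :: "phase_fun set"
    and B0 :: "real^3 \<Rightarrow> real^3"
  defines "\<Omega> \<equiv> \<Omega>x \<times> \<Omega>v"
  assumes classes: "phase_space_classes \<Omega>x \<Omega>v V U W"
    and B0_smooth: "smooth_on \<Omega>x B0"
    and B0_div_free: "\<And>x. x \<in> \<Omega>x \<Longrightarrow> divergence B0 x = 0"
    and B0_class: "\<And>i. (\<lambda>z. B0 (fst z) $ i) \<in> W"
  shows
    "(\<forall>F G H. is_functional \<Omega> V U W F \<longrightarrow> is_functional \<Omega> V U W G \<longrightarrow> is_functional \<Omega> V U W H \<longrightarrow>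
        (\<forall>a b. \<forall>f\<in>V.
           magnetic_bracket \<Omega> V B0 (\<lambda>h. a * F h + b * G h) H f
             = a * magnetic_bracket \<Omega> V B0 F H f + b * magnetic_bracket \<Omega> V B0 G H f \<and>
           magnetic_bracket \<Omega> V B0 H (\<lambda>h. a * F h + b * G h) f
             = a * magnetic_bracket \<Omega> V B0 H F f + b * magnetic_bracket \<Omega> V B0 H G f)) \<and>
     (\<forall>F G. is_functional \<Omega> V U W F \<longrightarrow> is_functional \<Omega> V U W G \<longrightarrow>
        (\<forall>f\<in>V. magnetic_bracket \<Omega> V B0 F G f = - magnetic_bracket \<Omega> V B0 G F f)) \<and>
     (\<forall>F G H. is_functional \<Omega> V U W F \<longrightarrow> is_functional \<Omega> V U W G \<longrightarrow> is_functional \<Omega> V U W H \<longrightarrow>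
        variationally_differentiable \<Omega> V W (magnetic_bracket \<Omega> V B0 F G) \<longrightarrow>
        variationally_differentiable \<Omega> V W (magnetic_bracket \<Omega> V B0 G H) \<longrightarrow>
        variationally_differentiable \<Omega> V W (magnetic_bracket \<Omega> V B0 H F) \<longrightarrow>
        (\<forall>f\<in>V.
           magnetic_bracket \<Omega> V B0 (magnetic_bracket \<Omega> V B0 F G) H f
         + magnetic_bracket \<Omega> V B0 (magnetic_bracket \<Omega> V B0 G H) F f
         + magnetic_bracket \<Omega> V B0 (magnetic_bracket \<Omega> V B0 H F) G f = 0))"
proof -
  interpret magnetic_phase_space \<Omega>x \<Omega>v V U W B0
    by (intro magnetic_phase_space.intro magnetic_phase_space_axioms.intro classes B0_smooth B0_class)
  have vd: "variationally_differentiable (\<Omega>x \<times> \<Omega>v) V W F" if "is_functional (\<Omega>x \<times> \<Omega>v) V U W F" for F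
    using that by (simp add: is_functional_def)
  show ?thesis
    unfolding \<Omega>_def
  proof (intro conjI allI impI ballI)
    fix F G H f and a b :: real
    assume "is_functional (\<Omega>x \<times> \<Omega>v) V U W F" "is_functional (\<Omega>x \<times> \<Omega>v) V U W G"
      "is_functional (\<Omega>x \<times> \<Omega>v) V U W H" and f: "f \<in> V"
    note FGH = this(1-3)[THEN vd]
    show "magnetic_bracket (\<Omega>x \<times> \<Omega>v) V B0 (\<lambda>h. a * F h + b * G h) H f
        = a * magnetic_bracket (\<Omega>x \<times> \<Omega>v) V B0 F H f + b * magnetic_bracket (\<Omega>x \<times> \<Omega>v) V B0 G H f"
      by (rule magnetic_bracket_linear_left[OF FGH f])
    show "magnetic_bracket (\<Omega>x \<times> \<Omega>v) V B0 H (\<lambda>h. a * F h + b * G h) f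
        = a * magnetic_bracket (\<Omega>x \<times> \<Omega>v) V B0 H F f + b * magnetic_bracket (\<Omega>x \<times> \<Omega>v) V B0 H G f"
      by (rule magnetic_bracket_linear_right[OF FGH f])
  qed (rule magnetic_bracket_antisym magnetic_bracket_jacobi[OF B0_div_free]; assumption)+
qed

end
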